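(* Let $n\ge 1$ and let $X$ be either a product of $n$ non-trivial metric trees or a Euclidean building of rank $n$. Then $\dim_L(X)=n$.
   Context: Lipschitz dimension: for $r>0$, an $r$-path in a metric space $X$ is a finite sequence $(x_1,\dots,x_k)$ in $X$ with $d(x_i,x_{i+1})\le r$ for $1\le i\le k-1$. Two points are in the same $r$-component of $X$ if some $r$-path in $X$ contains both. The $r$-components of a subset are those of the subset as a metric space. A map $f\colon X\to Y$ is Lipschitz light if there is $C>0$ such that $f$ is $C$-Lipschitz and, for every $r>0$ and every $W\subset Y$ with $\mathrm{diam}(W)\le r$, the $r$-components of $f^{-1}(W)$ have diameter at most $Cr$. $\dim_L(X)$ is the minimal integer $n\ge0$ such that there is a Lipschitz light map $X\to\mathbb{R}^n$ (with $\mathbb{R}^0$ a one-point space), or $\infty$ if there is none. Products carry the $\ell_\infty$ (maximum) combination of the metrics of the factors. Metric tree: a geodesic metric space $T$ such that all geodesic triangles are degenerate: every two points $x,y\in T$ can be joined by a curve $\gamma_{xy}$ of length $d(x,y)$, and $\gamma_{xz}\subseteq\gamma_{xy}\cup\gamma_{yz}$ for all $x,y,z\in T$. No compactness or local finiteness is assumed. Non-trivial means having more than one point. Euclidean building of rank $n$ (in the sense of Kleiner--Leeb): let $E$ be an $n$-dimensional Euclidean space and $W_{\mathrm{aff}}$ a group of isometries of $E$ generated by reflections in affine hyperplanes whose group $W$ of linear parts is finite. Let $\partial_T E$ be the unit sphere of directions of $E$ with the angular metric, $\Delta_{\mathrm{mod}}=\partial_TE/W$ with the quotient metric, and $\theta\colon\partial_TE\to\Delta_{\mathrm{mod}}$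 the projection; each nontrivial oriented segment of $E$ has a $\Delta_{\mathrm{mod}}$-direction given by $\theta$ of its direction. A Euclidean building modelled on $(E,W_{\mathrm{aff}})$ is a complete CAT(0) space $X$ with the following structure. (1) Each nontrivial oriented geodesic segment $\overline{xy}$ of $X$ is assigned a direction $\theta(\overline{xy})\in\Delta_{\mathrm{mod}}$ such that $d(\theta(\overline{xy}),\theta(\overline{xz}))$ is at most the Euclidean comparison angle at $x$ of the triangle $x,y,z$. (2) The angle at $x$ between $\overline{xy}$ and $\overline{xz}$ belongs to the finite set of distances between points of $\theta^{-1}(\theta(\overline{xy}))$ and points of $\theta^{-1}(\theta(\overline{xz}))$ in $\partial_TE$. (3) There is a family $\mathcal{A}$ of isometric embeddings $\iota\colon E\to X$ (charts) preserving $\Delta_{\mathrm{mod}}$-directions and closed under precomposition with elements of $W_{\mathrm{aff}}$, such that each geodesic segment, ray and complete geodesic of $X$ is contained in the image of a chart. (4) For charts $\iota_1,\iota_2\in\mathcal{A}$ whose images intersect, the transition map $\iota_2^{-1}\circ\iota_1\colon\iota_1^{-1}(\iota_2(E))\to E$ is the restriction of an element of $W_{\mathrm{aff}}$. The rank is $n=\dim E$. *)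

theory Defs
  imports "HOL-Analysis.Analysis"
begin

section \<open>Lipschitz dimension\<close>

definition mdiam :: "'a metric \<Rightarrow> 'a set \<Rightarrow> ennreal" where
  "mdiam m S = (SUP (x, y) \<in> S \<times> S. ennreal (mdist m x y))"

definition r_path :: "'a metric \<Rightarrow> real \<Rightarrow> 'a list \<Rightarrow> bool" where
  "r_path m r xs \<longleftrightarrow> xs \<noteq> [] \<and> set xs \<subseteq> mspace m \<and>
     (\<forall>i. Suc i < length xs \<longrightarrow> mdist m (xs ! i) (xs ! Suc i) \<le> r)"

definition same_r_component :: "'a metric \<Rightarrow> real \<Rightarrow> 'a \<Rightarrow> 'a \<Rightarrow> bool" where
  "same_r_component m r x y \<longleftrightarrow> (\<exists>xs. r_path m r xs \<and> x \<in> set xs \<and> y \<in> set xs)"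

definition r_components :: "'a metric \<Rightarrow> real \<Rightarrow> 'a set set" where
  "r_components m r = (\<lambda>x. {y. same_r_component m r x y}) ` mspace m"

definition Lipschitz_light :: "'a metric \<Rightarrow> 'b metric \<Rightarrow> ('a \<Rightarrow> 'b) \<Rightarrow> bool" where
  "Lipschitz_light X Y f \<longleftrightarrow> f \<in> mspace X \<rightarrow> mspace Y \<and>
     (\<exists>C>0. (\<forall>x\<in>mspace X. \<forall>y\<in>mspace X. mdist Y (f x) (f y) \<le> C * mdist X x y) \<and>
        (\<forall>r>0. \<forall>W. W \<subseteq> mspace Y \<and> mdiam Y W \<le> ennreal r \<longrightarrow>
           (\<forall>K \<in> r_components (submetric X {x \<in> mspace X. f x \<in> W}) r.
              mdiam X K \<le> ennreal (C * r))))"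

text \<open>\<open>\<real>\<^sup>n\<close> for varying \<open>n\<close>: the carrier is that of \<^const>\<open>Euclidean_space\<close>, a single point
  for \<open>n = 0\<close>.\<close>

definition real_space :: "nat \<Rightarrow> (nat \<Rightarrow> real) metric" where
  "real_space n = metric ({x. \<forall>i\<ge>n. x i = 0}, \<lambda>x y. L2_set (\<lambda>i. x i - y i) {..<n})"

text \<open>The infimum in \<^typ>\<open>enat\<close> is the minimum, and \<open>\<infinity>\<close> for the empty set.\<close>

definition Lipschitz_dim :: "'a metric \<Rightarrow> enat" where
  "Lipschitz_dim X = Inf {enat n |n. \<exists>f. Lipschitz_light X (real_space n) f}"


section \<open>Products\<close>

text \<open>Inserting \<open>0\<close> does not change the maximum for \<open>n \<ge> 1\<close>; it only makes the empty product a
  metric space too.\<close>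

definition max_product :: "nat \<Rightarrow> (nat \<Rightarrow> 'a metric) \<Rightarrow> (nat \<Rightarrow> 'a) metric" where
  "max_product n T = metric (Pi\<^sub>E {..<n} (\<lambda>i. mspace (T i)),
     \<lambda>x y. Max (insert 0 ((\<lambda>i. mdist (T i) (x i) (y i)) ` {..<n})))"


section \<open>Metric trees\<close>

definition curve_length :: "'a metric \<Rightarrow> (real \<Rightarrow> 'a) \<Rightarrow> ennreal" where
  "curve_length m g = (SUP ts \<in> {ts. ts \<noteq> [] \<and> sorted ts \<and> set ts \<subseteq> {0..1}}.
     \<Sum>i<length ts - 1. ennreal (mdist m (g (ts ! i)) (g (ts ! Suc i))))"

definition geodesic_curve :: "'a metric \<Rightarrow> 'a \<Rightarrow> 'a \<Rightarrow> (real \<Rightarrow> 'a) \<Rightarrow> bool" where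
  "geodesic_curve m x y g \<longleftrightarrow>
     continuous_map (top_of_set {0..1}) (mtopology_of m) g \<and> g 0 = x \<and> g 1 = y \<and>
     curve_length m g = ennreal (mdist m x y)"

definition metric_tree :: "'a metric \<Rightarrow> bool" where
  "metric_tree m \<longleftrightarrow>
     (\<forall>x\<in>mspace m. \<forall>y\<in>mspace m. \<exists>g. geodesic_curve m x y g) \<and>
     (\<forall>x\<in>mspace m. \<forall>y\<in>mspace m. \<forall>z\<in>mspace m. \<forall>a b c.
        geodesic_curve m x y a \<and> geodesic_curve m y z b \<and> geodesic_curve m x z c \<longrightarrow>
        c ` {0..1} \<subseteq> a ` {0..1} \<union> b ` {0..1})"

definition nontrivial :: "'a metric \<Rightarrow> bool" where
  "nontrivial m \<longleftrightarrow> (\<exists>x\<in>mspace m. \<exists>y\<in>mspace m. x \<noteq> y)"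


section \<open>CAT(0) spaces\<close>

definition isometric_on :: "'a metric \<Rightarrow> 'e::metric_space set \<Rightarrow> ('e \<Rightarrow> 'a) \<Rightarrow> bool" where
  "isometric_on m S g \<longleftrightarrow> g ` S \<subseteq> mspace m \<and> (\<forall>s\<in>S. \<forall>t\<in>S. mdist m (g s) (g t) = dist s t)"

definition geodesic_segment :: "'a metric \<Rightarrow> 'a \<Rightarrow> 'a \<Rightarrow> (real \<Rightarrow> 'a) \<Rightarrow> bool" where
  "geodesic_segment m x y g \<longleftrightarrow>
     isometric_on m {0..mdist m x y} g \<and> g 0 = x \<and> g (mdist m x y) = y"

text \<open>The comparison triangle is \<open>x' y' z'\<close>, with comparison points \<open>p'\<close>, \<open>q'\<close>. Since \<open>x\<close>, \<open>y\<close>, \<open>z\<close>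
  are arbitrary, the two sides issuing from \<open>x\<close> represent any pair of sides.\<close>

definition CAT0 :: "'a metric \<Rightarrow> bool" where
  "CAT0 m \<longleftrightarrow>
     (\<forall>x\<in>mspace m. \<forall>y\<in>mspace m. \<exists>g. geodesic_segment m x y g) \<and>
     (\<forall>x\<in>mspace m. \<forall>y\<in>mspace m. \<forall>z\<in>mspace m. \<forall>g h.
        geodesic_segment m x y g \<and> geodesic_segment m x z h \<longrightarrow>
        (\<forall>s\<in>{0..mdist m x y}. \<forall>t\<in>{0..mdist m x z}. \<forall>x' y' z' p' q' :: real^2.
           dist x' y' = mdist m x y \<and> dist x' z' = mdist m x z \<and> dist y' z' = mdist m y z \<and>
           p' \<in> closed_segment x' y' \<and> dist x' p' = s \<and>
           q' \<in> closed_segment x' z' \<and> dist x' q' = t \<longrightarrow>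
           mdist m (g s) (h t) \<le> dist p' q'))"

text \<open>By the Euclidean law of cosines; meaningful for \<open>y \<noteq> x\<close> and \<open>z \<noteq> x\<close>.\<close>

definition comparison_angle :: "'a metric \<Rightarrow> 'a \<Rightarrow> 'a \<Rightarrow> 'a \<Rightarrow> real" where
  "comparison_angle m x y z =
     arccos (((mdist m x y)\<^sup>2 + (mdist m x z)\<^sup>2 - (mdist m y z)\<^sup>2) / (2 * mdist m x y * mdist m x z))"

text \<open>The Alexandrov angle at the common origin \<open>g 0 = h 0\<close>. The comparison angles lie in
  \<open>[0, \<pi>]\<close>, so the upper limit is finite.\<close>

definition Alexandrov_angle :: "'a metric \<Rightarrow> (real \<Rightarrow> 'a) \<Rightarrow> (real \<Rightarrow> 'a) \<Rightarrow> real" where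
  "Alexandrov_angle m g h = real_of_ereal
     (Limsup (at_right 0 \<times>\<^sub>F at_right 0)
        (\<lambda>(s, t). ereal (comparison_angle m (g 0) (g s) (h t))))"


section \<open>Affine reflection groups\<close>

definition hyperplane_reflection :: "'e::euclidean_space \<Rightarrow> real \<Rightarrow> 'e \<Rightarrow> 'e" where
  "hyperplane_reflection a b x = x - (2 * (a \<bullet> x - b) / (a \<bullet> a)) *\<^sub>R a"

inductive_set generated_group :: "('e \<Rightarrow> 'e) set \<Rightarrow> ('e \<Rightarrow> 'e) set" for R where
  "id \<in> generated_group R"
| "g \<in> R \<Longrightarrow> g \<in> generated_group R"
| "g \<in> generated_group R \<Longrightarrow> h \<in> generated_group R \<Longrightarrow> g \<circ> h \<in> generated_group R"
| "g \<in> generated_group R \<Longrightarrow> inv g \<in> generated_group R"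

definition linear_parts :: "('e::euclidean_space \<Rightarrow> 'e) set \<Rightarrow> ('e \<Rightarrow> 'e) set" where
  "linear_parts G = (\<lambda>g v. g v - g 0) ` G"

definition affine_reflection_group :: "('e::euclidean_space \<Rightarrow> 'e) set \<Rightarrow> bool" where
  "affine_reflection_group G \<longleftrightarrow>
     (\<exists>R. R \<subseteq> {hyperplane_reflection a b |a b. a \<noteq> 0} \<and> G = generated_group R) \<and>
     finite (linear_parts G)"

text \<open>The unit sphere is \<open>\<partial>\<^sub>T E\<close>. Points of \<open>\<Delta>\<^sub>m\<^sub>o\<^sub>d\<close> are the \<open>W\<close>-orbits in it, as sets of unit
  vectors; so the preimage of such a point in the sphere is that set itself.\<close>

definition direction_angle :: "'e::euclidean_space \<Rightarrow> 'e \<Rightarrow> real" where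
  "direction_angle u v = arccos (u \<bullet> v)"

definition direction_class :: "('e::euclidean_space \<Rightarrow> 'e) set \<Rightarrow> 'e \<Rightarrow> 'e set" where
  "direction_class W u = (\<lambda>w. w u) ` W"

definition Delta_mod :: "('e::euclidean_space \<Rightarrow> 'e) set \<Rightarrow> 'e set set" where
  "Delta_mod W = direction_class W ` sphere 0 1"

definition Delta_distances :: "'e::euclidean_space set \<Rightarrow> 'e set \<Rightarrow> real set" where
  "Delta_distances \<alpha> \<beta> = {direction_angle u v |u v. u \<in> \<alpha> \<and> v \<in> \<beta>}"

definition Delta_dist :: "'e::euclidean_space set \<Rightarrow> 'e set \<Rightarrow> real" where
  "Delta_dist \<alpha> \<beta> = Inf (Delta_distances \<alpha> \<beta>)"


section \<open>Euclidean buildings\<close>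

text \<open>The building is modelled on \<open>(E, W\<^sub>a\<^sub>f\<^sub>f)\<close>, where \<open>E\<close> is the type \<open>'e\<close>; its rank is \<open>DIM('e)\<close>.
  Geodesics in a CAT(0) space are determined by their end points, so \<open>\<theta> x y\<close> is the direction of
  the segment from \<open>x\<close> to \<open>y\<close>. In axiom \<open>chart_geodesic\<close> segments may be degenerate, so that every
  point lies in the image of a chart.\<close>

locale euclidean_building =
  fixes Waff :: "('e::euclidean_space \<Rightarrow> 'e) set"
    and X :: "'a metric"
    and \<theta> :: "'a \<Rightarrow> 'a \<Rightarrow> 'e set"
    and charts :: "('e \<Rightarrow> 'a) set"
  assumes reflection_group: "affine_reflection_group Waff"
    and nonempty: "mspace X \<noteq> {}"
    and complete: "mcomplete_of X"
    and CAT0: "CAT0 X"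
    and direction_mem:
      "\<lbrakk>x \<in> mspace X; y \<in> mspace X; x \<noteq> y\<rbrakk> \<Longrightarrow> \<theta> x y \<in> Delta_mod (linear_parts Waff)"
    and direction_comparison:
      "\<lbrakk>x \<in> mspace X; y \<in> mspace X; z \<in> mspace X; y \<noteq> x; z \<noteq> x\<rbrakk>
       \<Longrightarrow> Delta_dist (\<theta> x y) (\<theta> x z) \<le> comparison_angle X x y z"
    and angle_rigidity:
      "\<lbrakk>x \<in> mspace X; y \<in> mspace X; z \<in> mspace X; y \<noteq> x; z \<noteq> x;
        geodesic_segment X x y g; geodesic_segment X x z h\<rbrakk>
       \<Longrightarrow> Alexandrov_angle X g h \<in> Delta_distances (\<theta> x y) (\<theta> x z)"
    and chart_isometric: "\<iota> \<in> charts \<Longrightarrow> isometric_on X UNIV \<iota>"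
    and chart_direction:
      "\<lbrakk>\<iota> \<in> charts; p \<noteq> q\<rbrakk> \<Longrightarrow> \<theta> (\<iota> p) (\<iota> q) = direction_class (linear_parts Waff) (sgn (q - p))"
    and chart_precomp: "\<lbrakk>\<iota> \<in> charts; w \<in> Waff\<rbrakk> \<Longrightarrow> \<iota> \<circ> w \<in> charts"
    and chart_geodesic:
      "\<lbrakk>I \<in> {{0..l} |l. 0 \<le> l} \<union> {{0..}, UNIV}; isometric_on X (I :: real set) c\<rbrakk>
       \<Longrightarrow> \<exists>\<iota>\<in>charts. c ` I \<subseteq> range \<iota>"
    and chart_transition:
      "\<lbrakk>\<iota>\<^sub>1 \<in> charts; \<iota>\<^sub>2 \<in> charts; range \<iota>\<^sub>1 \<inter> range \<iota>\<^sub>2 \<noteq> {}\<rbrakk>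
       \<Longrightarrow> \<exists>w\<in>Waff. \<forall>p \<in> \<iota>\<^sub>1 -` range \<iota>\<^sub>2. (inv \<iota>\<^sub>2 \<circ> \<iota>\<^sub>1) p = w p"


section \<open>Well-definedness of the metrics\<close>

text \<open>The constructor \<^const>\<open>metric\<close> is unspecified outside metric spaces.\<close>

lemma Metric_space_real_space:
  fixes n :: nat
  shows "Metric_space {x. \<forall>i\<ge>n. x i = 0} (\<lambda>x y. L2_set (\<lambda>i. x i - y i :: real) {..<n})"
proof
  fix x y :: "nat \<Rightarrow> real"
  show "0 \<le> L2_set (\<lambda>i. x i - y i) {..<n}" by simp
  show "L2_set (\<lambda>i. x i - y i) {..<n} = L2_set (\<lambda>i. y i - x i) {..<n}"
    by (simp add: L2_set_def power2_commute)
  assume "x \<in> {x. \<forall>i\<ge>n. x i = 0}" "y \<in> {x. \<forall>i\<ge>n. x i = 0}"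
  then show "L2_set (\<lambda>i. x i - y i) {..<n} = 0 \<longleftrightarrow> x = y"
    by (simp add: L2_set_eq_0_iff fun_eq_iff) (metis lessThan_iff not_less)
  fix z :: "nat \<Rightarrow> real"
  show "L2_set (\<lambda>i. x i - z i) {..<n} \<le> L2_set (\<lambda>i. x i - y i) {..<n} + L2_set (\<lambda>i. y i - z i) {..<n}"
    using L2_set_triangle_ineq[of "\<lambda>i. x i - y i" "\<lambda>i. y i - z i" "{..<n}"] by simp
qed

lemma mspace_real_space [simp]: "mspace (real_space n) = {x. \<forall>i\<ge>n. x i = 0}"
  and mdist_real_space: "mdist (real_space n) x y = L2_set (\<lambda>i. x i - y i) {..<n}"
  unfolding real_space_def
  by (simp_all only: Metric_space.mspace_metric[OF Metric_space_real_space]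
      Metric_space.mdist_metric[OF Metric_space_real_space])

lemma Metric_space_max_product:
  fixes n :: nat and T :: "nat \<Rightarrow> 'a metric"
  shows "Metric_space (Pi\<^sub>E {..<n} (\<lambda>i. mspace (T i)))
     (\<lambda>x y. Max (insert 0 ((\<lambda>i. mdist (T i) (x i) (y i)) ` {..<n})))"
  (is "Metric_space ?M ?d")
proof
  fix x y :: "nat \<Rightarrow> 'a"
  have le: "mdist (T i) (u i) (v i) \<le> ?d u v" if "i < n" for u v i
    using that by (intro Max_ge) auto
  show "0 \<le> ?d x y" by (intro Max_ge) auto
  show "?d x y = ?d y x" by (simp add: mdist_commute)
  assume x: "x \<in> ?M" and y: "y \<in> ?M"
  show "?d x y = 0 \<longleftrightarrow> x = y"
  proof
    assume *: "?d x y = 0"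
    show "x = y"
    proof (rule PiE_ext[OF x y])
      fix i assume i: "i \<in> {..<n}"
      then have "mdist (T i) (x i) (y i) = 0"
        using le[of i x y] * by (simp add: order_antisym)
      with i x y show "x i = y i" by (auto simp: PiE_iff)
    qed
  next
    assume "x = y"
    moreover have "(\<lambda>i. mdist (T i) (y i) (y i)) ` {..<n} \<subseteq> {0}" using y by (auto simp: PiE_iff)
    ultimately show "?d x y = 0"
      by (metis insert_absorb2 Max_singleton subset_singletonD)
  qed
  fix z assume z: "z \<in> ?M"
  show "?d x z \<le> ?d x y + ?d y z"
  proof (intro Max.boundedI)
    fix a assume "a \<in> insert 0 ((\<lambda>i. mdist (T i) (x i) (z i)) ` {..<n})"
    moreover have "0 \<le> ?d x y" "0 \<le> ?d y z" by (intro Max_ge; auto)+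
    moreover have "mdist (T i) (x i) (z i) \<le> ?d x y + ?d y z" if i: "i < n" for i
    proof -
      have "mdist (T i) (x i) (z i) \<le> mdist (T i) (x i) (y i) + mdist (T i) (y i) (z i)"
        using i x y z by (intro mdist_triangle) (auto simp: PiE_iff)
      with le[OF i, of x y] le[OF i, of y z] show ?thesis by linarith
    qed
    ultimately show "a \<le> ?d x y + ?d y z" by auto
  qed auto
qed

lemma mspace_max_product [simp]: "mspace (max_product n T) = Pi\<^sub>E {..<n} (\<lambda>i. mspace (T i))"
  and mdist_max_product:
    "mdist (max_product n T) x y = Max (insert 0 ((\<lambda>i. mdist (T i) (x i) (y i)) ` {..<n}))"
  unfolding max_product_def
  by (simp_all only: Metric_space.mspace_metric[OF Metric_space_max_product]
      Metric_space.mdist_metric[OF Metric_space_max_product])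

end

theory Submission
  imports Defs
begin

text \<open>
  \<^bold>\<open>The lower bound.\<close> Both kinds of spaces contain a bilipschitz copy of the
  cube \<open>[0,1]\<^sup>n\<close>, so it suffices that a Lipschitz light map from such a cube
  to \<open>\<real>\<^sup>k\<close> forces \<open>n \<le> k\<close>
  (\<open>Lipschitz_light_cube_dim\<close>). Kuhn's lemma, the combinatorial core of Brouwer's
  theorem, yields the Hex theorem (\<open>hex_chain\<close>): if a fine grid in the cube is
  coloured with \<open>n\<close> colours, then some colour \<open>i\<close> contains a chain of
  neighbouring grid points that joins the two faces orthogonal to the \<open>i\<close>-th axis.
  On the other hand \<open>\<real>\<^sup>k\<close> is covered by \<open>k + 1\<close> families
  of small, mutually separated cubes, namely \<open>k + 1\<close> diagonal translates of a
  lattice of shrunken cubes. If \<open>k < n\<close>, the families serve as colours of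
  the grid via the given map. A long monochromatic chain then stays over a single cube, since
  its steps are shorter than the gaps, and this contradicts lightness.

  \<^bold>\<open>The upper bound for trees.\<close> In a metric tree the distance to a base
  point is Lipschitz light: by \<open>0\<close>-hyperbolicity all points of a chain with short
  steps and nearly constant height branch off one geodesic at nearly this height, so that they
  stay together (\<open>metric_tree_chain\<close>). For a product of trees the distances in the
  factors together form a light map.

  \<^bold>\<open>The upper bound for buildings.\<close> Here the distance to a base point is
  replaced by a retraction to an apartment, centred at a regular point at infinity. Fix a unit
  vector \<open>u\<^sub>0\<close> that no nontrivial element of the finite group
  \<open>W\<close> fixes. A segment whose direction is close to the orbit of
  \<open>u\<^sub>0\<close> has a unique representative of its direction close to
  \<open>u\<^sub>0\<close>, and hence becomes a vector in \<open>E\<close>. Let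
  \<open>p\<^sub>T\<close> be the point with coordinate \<open>T u\<^sub>0\<close> in a fixed
  apartment. The map \<open>F\<close> sends \<open>x\<close> to \<open>T u\<^sub>0\<close> minus
  the vector from \<open>x\<close> to \<open>p\<^sub>T\<close>; this does not depend on
  \<open>T\<close> if \<open>T\<close> is large (\<open>horospherical_limit\<close>). The
  comparison axiom makes \<open>F\<close> \<open>1\<close>-Lipschitz. For lightness
  (\<open>horospherical_map\<close>), take a chain \<open>z\<^sub>0, \<dots>, z\<^sub>k\<close>
  of step \<open>r\<close> on which \<open>F\<close> varies by at most \<open>r\<close>, and the
  point \<open>q\<close> at distance \<open>M r\<close> from \<open>z\<^sub>0\<close> on the
  segment from \<open>z\<^sub>0\<close> to \<open>p\<^sub>T\<close>. The angle at
  \<open>q\<close> between \<open>z\<^sub>0\<close> and \<open>p\<^sub>T\<close> is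
  \<open>\<pi>\<close>. Passing from \<open>z\<^sub>i\<close> to
  \<open>z\<^sub>i\<^sub>+\<^sub>1\<close> can change this angle only a little, and if the angle
  is nearly \<open>\<pi>\<close>, then the discreteness of angles makes the triangle with
  corners \<open>z\<^sub>i\<close>, \<open>q\<close>, \<open>p\<^sub>T\<close> exactly
  Euclidean: the vector from \<open>z\<^sub>i\<close> to \<open>q\<close> plus the vector from
  \<open>q\<close> to \<open>p\<^sub>T\<close> is the vector from \<open>z\<^sub>i\<close> to
  \<open>p\<^sub>T\<close> (\<open>straight_angle_transfer\<close>). So the vector from
  \<open>z\<^sub>i\<close> to \<open>q\<close> is determined by \<open>F z\<^sub>i\<close>.
  Therefore the errors do not accumulate along the chain, and every \<open>z\<^sub>i\<close> is
  within about \<open>M r\<close> of \<open>q\<close>.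
\<close>

section \<open>Chains and Lipschitz light maps\<close>

lemma same_r_component_iff_chain:
  "same_r_component m r x y \<longleftrightarrow>
     (\<exists>z k. z 0 = x \<and> z k = y \<and> (\<forall>i\<le>k. z i \<in> mspace m) \<and>
        (\<forall>i<k. mdist m (z i) (z (Suc i)) \<le> r))"  (is "?L \<longleftrightarrow> ?R")
proof
  assume ?L
  then obtain xs where xs: "r_path m r xs" "x \<in> set xs" "y \<in> set xs"
    by (auto simp: same_r_component_def)
  then obtain a b where a: "a < length xs" "xs ! a = x" and b: "b < length xs" "xs ! b = y"
    by (metis in_set_conv_nth)
  have mem: "xs ! i \<in> mspace m" if "i < length xs" for i
    using xs(1) that by (auto simp: r_path_def)
  have step: "mdist m (xs ! i) (xs ! Suc i) \<le> r" if "Suc i < length xs" for i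
    using xs(1) that by (auto simp: r_path_def)
  show ?R
  proof (cases "a \<le> b")
    case True
    then show ?thesis
      using a b mem step by (intro exI[of _ "\<lambda>i. xs ! (a + i)"] exI[of _ "b - a"]) auto
  next
    case False
    have "mdist m (xs ! (a - i)) (xs ! (a - Suc i)) \<le> r" if "i < a - b" for i
    proof -
      have "Suc (a - Suc i) = a - i" using that by simp
      then show ?thesis using step[of "a - Suc i"] a(1) by (simp add: mdist_commute)
    qed
    then show ?thesis
      using False a b mem by (intro exI[of _ "\<lambda>i. xs ! (a - i)"] exI[of _ "a - b"]) auto
  qed
next
  assume ?R
  then obtain z k where z: "z 0 = x" "z k = y" "\<forall>i\<le>k. z i \<in> mspace m"
    "\<forall>i<k. mdist m (z i) (z (Suc i)) \<le> r" by blast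
  have "r_path m r (map z [0..<Suc k])"
    unfolding r_path_def using z(3,4) by (auto simp: nth_append less_Suc_eq simp del: upt_Suc)
  moreover have "x \<in> set (map z [0..<Suc k])" "y \<in> set (map z [0..<Suc k])"
    using z(1,2) by (auto simp del: upt_Suc)
  ultimately show ?L unfolding same_r_component_def by blast
qed

lemma same_r_component_sym: "same_r_component m r x y \<Longrightarrow> same_r_component m r y x"
  by (auto simp: same_r_component_def)

lemma same_r_component_trans:
  assumes "same_r_component m r x y" "same_r_component m r y w"
  shows "same_r_component m r x w"
proof -
  obtain z k where z: "z 0 = x" "z k = y" "\<forall>i\<le>k. z i \<in> mspace m"
    "\<forall>i<k. mdist m (z i) (z (Suc i)) \<le> r"
    using assms(1) unfolding same_r_component_iff_chain by blast
  obtain z' k' where z': "z' 0 = y" "z' k' = w" "\<forall>i\<le>k'. z' i \<in> mspace m"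
    "\<forall>i<k'. mdist m (z' i) (z' (Suc i)) \<le> r"
    using assms(2) unfolding same_r_component_iff_chain by blast
  define u where "u i = (if i \<le> k then z i else z' (i - k))" for i
  have "mdist m (u i) (u (Suc i)) \<le> r" if "i < k + k'" for i
  proof (cases "i < k")
    case True then show ?thesis using z(4) by (simp add: u_def)
  next
    case False
    then have "u i = z' (i - k)" "u (Suc i) = z' (Suc (i - k))"
      using z(2) z'(1) by (auto simp: u_def Suc_diff_le)
    then show ?thesis using z'(4) that False by simp
  qed
  moreover have "u i \<in> mspace m" if "i \<le> k + k'" for i
    using z(3) z'(3) that by (auto simp: u_def)
  moreover have "u 0 = x" "u (k + k') = w" using z(1,2) z'(1,2) by (auto simp: u_def)
  ultimately show ?thesis unfolding same_r_component_iff_chain by blast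
qed

text \<open>The defining condition on \<open>r\<close>-components becomes a condition on finite chains:
  two points of one component are the ends of a chain, and a chain can be tested against
  \<open>W\<close> being its own image. All later estimates are about chains.\<close>

lemma Lipschitz_light_iff_chain:
  "Lipschitz_light X Y f \<longleftrightarrow> f \<in> mspace X \<rightarrow> mspace Y \<and>
     (\<exists>C>0. (\<forall>x\<in>mspace X. \<forall>y\<in>mspace X. mdist Y (f x) (f y) \<le> C * mdist X x y) \<and>
        (\<forall>r>0. \<forall>z k. (\<forall>i\<le>k. z i \<in> mspace X) \<longrightarrow> (\<forall>i<k. mdist X (z i) (z (Suc i)) \<le> r) \<longrightarrow>
           (\<forall>i\<le>k. \<forall>j\<le>k. mdist Y (f (z i)) (f (z j)) \<le> r) \<longrightarrow> mdist X (z 0) (z k) \<le> C * r))"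
proof -
  have "(\<forall>W. W \<subseteq> mspace Y \<and> mdiam Y W \<le> ennreal r \<longrightarrow>
           (\<forall>K \<in> r_components (submetric X {x \<in> mspace X. f x \<in> W}) r. mdiam X K \<le> ennreal (C * r)))
    \<longleftrightarrow> (\<forall>z k. (\<forall>i\<le>k. z i \<in> mspace X) \<longrightarrow> (\<forall>i<k. mdist X (z i) (z (Suc i)) \<le> r) \<longrightarrow>
           (\<forall>i\<le>k. \<forall>j\<le>k. mdist Y (f (z i)) (f (z j)) \<le> r) \<longrightarrow> mdist X (z 0) (z k) \<le> C * r)"
    (is "?L \<longleftrightarrow> ?R") if f: "f \<in> mspace X \<rightarrow> mspace Y" and r: "0 < r" and C: "0 < C" for r C
  proof
    assume L: ?L
    show ?R
    proof (intro allI impI)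
      fix z k assume z: "\<forall>i\<le>k. z i \<in> mspace X" "\<forall>i<k. mdist X (z i) (z (Suc i)) \<le> r"
        "\<forall>i\<le>k. \<forall>j\<le>k. mdist Y (f (z i)) (f (z j)) \<le> r"
      define W where "W = (\<lambda>i. f (z i)) ` {..k}"
      let ?m = "submetric X {x \<in> mspace X. f x \<in> W}"
      let ?K = "{y. same_r_component ?m r (z 0) y}"
      have "W \<subseteq> mspace Y" using f z(1) by (auto simp: W_def)
      moreover have "mdiam Y W \<le> ennreal r"
        unfolding mdiam_def using z(3) by (auto simp: W_def intro!: SUP_least ennreal_leI)
      moreover have zm: "z i \<in> mspace ?m" if "i \<le> k" for i using z(1) that by (auto simp: W_def)
      then have "?K \<in> r_components ?m r" by (auto simp: r_components_def)
      ultimately have K: "mdiam X ?K \<le> ennreal (C * r)" using L by blast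
      have "same_r_component ?m r (z 0) (z 0)"
        using zm[of 0] unfolding same_r_component_iff_chain
        by (intro exI[of _ "\<lambda>_. z 0"] exI[of _ 0]) simp
      moreover have "same_r_component ?m r (z 0) (z k)"
        unfolding same_r_component_iff_chain using z(2) zm
        by (intro exI[of _ z] exI[of _ k]) simp
      ultimately have "ennreal (mdist X (z 0) (z k)) \<le> mdiam X ?K"
        unfolding mdiam_def by (intro SUP_upper2[of "(z 0, z k)"]) auto
      then have "ennreal (mdist X (z 0) (z k)) \<le> ennreal (C * r)" using K by (rule order_trans)
      then show "mdist X (z 0) (z k) \<le> C * r" using r C by (simp add: ennreal_le_iff)
    qed
  next
    assume R: ?R
    show ?L
    proof (intro allI impI ballI)
      fix W K assume W: "W \<subseteq> mspace Y \<and> mdiam Y W \<le> ennreal r"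
        and K: "K \<in> r_components (submetric X {x \<in> mspace X. f x \<in> W}) r"
      let ?m = "submetric X {x \<in> mspace X. f x \<in> W}"
      have Wd: "mdist Y u v \<le> r" if "u \<in> W" "v \<in> W" for u v
      proof -
        have "ennreal (mdist Y u v) \<le> mdiam Y W"
          unfolding mdiam_def using that by (intro SUP_upper2[of "(u, v)"]) auto
        also have "\<dots> \<le> ennreal r" using W by simp
        finally show ?thesis using r by (simp add: ennreal_le_iff)
      qed
      have "mdist X x y \<le> C * r" if "x \<in> K" "y \<in> K" for x y
      proof -
        have "same_r_component ?m r x y"
          using K that same_r_component_trans[OF same_r_component_sym]
          by (fastforce simp: r_components_def)
        then obtain z k where z: "z 0 = x" "z k = y" "\<forall>i\<le>k. z i \<in> mspace ?m"
            "\<forall>i<k. mdist ?m (z i) (z (Suc i)) \<le> r"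
          unfolding same_r_component_iff_chain by blast
        then have "\<forall>i\<le>k. \<forall>j\<le>k. mdist Y (f (z i)) (f (z j)) \<le> r" using Wd by simp
        then show ?thesis using R z by auto
      qed
      then show "mdiam X K \<le> ennreal (C * r)"
        unfolding mdiam_def by (auto intro!: SUP_least ennreal_leI)
    qed
  qed
  then show ?thesis unfolding Lipschitz_light_def
    by (intro conj_cong refl ex_cong1 all_cong1 imp_cong)
qed

section \<open>The Hex theorem\<close>

text \<open>Label a grid point \<open>0\<close> in direction \<open>i\<close> if it lies on, or next to,
  the part of colour \<open>i\<close> that is connected to the face where the
  \<open>i\<close>-th coordinate vanishes. If no colour joined its two faces, this would be an
  admissible labelling for Kuhn's lemma, which gives a cell that shows both labels in every
  direction. But in the direction given by the colour of its base corner the label is constant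
  on the cell. Chains make steps of length up to \<open>2\<close>, so that two neighbours of one
  grid point are linked.\<close>

lemma hex_chain:
  fixes n p :: nat and col :: "(nat \<Rightarrow> nat) \<Rightarrow> nat"
  assumes p: "0 < p" and col: "\<And>x. (\<forall>i<n. x i \<le> p) \<Longrightarrow> col x < n"
  obtains i z k where "i < n" "\<forall>l\<le>k. (\<forall>j<n. z l j \<le> p) \<and> col (z l) = i"
    "\<forall>l<k. \<forall>j<n. z l j \<le> z (Suc l) j + 2 \<and> z (Suc l) j \<le> z l j + 2"
    "z 0 i = 0" "p \<le> z k i + 1"
proof -
  define G where "G = {x :: nat \<Rightarrow> nat. \<forall>i<n. x i \<le> p}"
  define near where "near d x y \<longleftrightarrow> (\<forall>j<n. x j \<le> y j + d \<and> y j \<le> x j + d)" for d :: nat and x y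
  define S where "S i x y \<longleftrightarrow> x \<in> G \<and> y \<in> G \<and> col x = i \<and> col y = i \<and> near 2 x y" for i x y
  define R where "R i = {y. \<exists>x. x \<in> G \<and> col x = i \<and> x i = 0 \<and> (S i)\<^sup>*\<^sup>* x y}" for i
  have RG: "y \<in> G \<and> col y = i" if yR: "y \<in> R i" for y i
  proof -
    obtain x where x: "x \<in> G" "col x = i" "(S i)\<^sup>*\<^sup>* x y" using yR unfolding R_def by blast
    from x(3,1,2) show ?thesis by (induction rule: rtranclp_induct) (auto simp: S_def)
  qed
  have R_step: "y' \<in> R i" if "y \<in> R i" "y' \<in> G" "col y' = i" "near 2 y y'" for y y' i
  proof -
    have "S i y y'" using RG[OF that(1)] that by (auto simp: S_def)
    then show ?thesis using that(1) unfolding R_def by (auto intro: rtranclp.rtrancl_into_rtrancl)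
  qed
  define label where "label x i = (if x i = 0 \<or> (\<exists>y\<in>R i. near 1 x y) then 0 else 1 :: nat)" for x i
  have "\<exists>i<n. \<exists>y\<in>R i. p \<le> y i + 1"
  proof (rule ccontr)
    assume neg: "\<not> ?thesis"
    have lab1: "\<forall>x. (\<forall>i<n. x i \<le> p) \<longrightarrow> (\<forall>i<n. x i = p \<longrightarrow> label x i = 1)"
      using neg p unfolding label_def near_def by fastforce
    obtain q where q: "\<forall>i<n. q i < p" "\<forall>i<n. \<exists>r s. (\<forall>j<n. q j \<le> r j \<and> r j \<le> q j + 1) \<and>
        (\<forall>j<n. q j \<le> s j \<and> s j \<le> q j + 1) \<and> label r i \<noteq> label s i"
      by (rule kuhn_lemma[OF p _ _ lab1]) (auto simp: label_def)
    have qG: "q \<in> G" using q(1) by (auto simp: G_def)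
    define i where "i = col q"
    have i: "i < n" using col qG by (simp add: i_def G_def)
    \<comment> \<open>The right-hand side does not depend on the vertex \<open>r\<close> of the cell.\<close>
    have lab: "label r i = 0 \<longleftrightarrow> q \<in> R i" if r: "\<forall>j<n. q j \<le> r j \<and> r j \<le> q j + 1" for r
    proof
      assume "q \<in> R i"
      moreover have "near 1 r q" using r by (fastforce simp: near_def)
      ultimately show "label r i = 0" by (auto simp: label_def)
    next
      assume "label r i = 0"
      then consider "r i = 0" | y where "y \<in> R i" "near 1 r y"
        by (auto simp: label_def split: if_splits)
      then show "q \<in> R i"
      proof cases
        case 1
        then have "q i = 0" using r i by fastforce
        then show ?thesis using qG unfolding R_def i_def by blast
      next
        case 2
        have "near 2 y q" using 2(2) r unfolding near_def by fastforce
        then show ?thesis using R_step[OF 2(1) qG] by (simp add: i_def)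
      qed
    qed
    obtain r s where rs: "\<forall>j<n. q j \<le> r j \<and> r j \<le> q j + 1" "\<forall>j<n. q j \<le> s j \<and> s j \<le> q j + 1"
        "label r i \<noteq> label s i" using q(2) i by blast
    have "label r i = 0 \<longleftrightarrow> label s i = 0" using lab[OF rs(1)] lab[OF rs(2)] by simp
    then show False using rs(3) by (auto simp: label_def split: if_splits)
  qed
  then obtain i y x where i: "i < n" and y: "y \<in> R i" "p \<le> y i + 1"
    and x: "x \<in> G" "col x = i" "x i = 0" "(S i)\<^sup>*\<^sup>* x y" by (auto simp: R_def)
  obtain k z where z: "z 0 = x" "z k = y" "\<forall>l<k. S i (z l) (z (Suc l))"
    using x(4) by (auto simp: rtranclp_power relpowp_fun_conv)
  have "z l \<in> G \<and> col (z l) = i" if "l \<le> k" for l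
    using that z x RG[OF y(1)] by (cases "l = k") (auto simp: S_def)
  then show ?thesis
    using i z x(3) y(2)
    by (intro that[of i k z]) (auto simp: S_def near_def G_def)
qed

section \<open>Cubes do not map lightly to spaces of lower dimension\<close>

lemma frac_gap_unique:
  fixes t :: real and N j j' :: nat
  assumes N: "j < N" "j' < N" and "frac (t - j / N) < 1 / N" "frac (t - j' / N) < 1 / N"
  shows "j = j'"
proof -
  have *: False if less: "j < j'" and N: "j' < N" and f: "frac (t - j / N) < 1 / N" "frac (t - j' / N) < 1 / N"
    for j j' :: nat
  proof -
    define a b where "a = \<lfloor>t - j / N\<rfloor>" and "b = \<lfloor>t - j' / N\<rfloor>"
    have N0: "0 < real N" using N by simp
    have fr: "0 \<le> (t - j / N) - a" "(t - j / N) - a < 1 / N" "0 \<le> (t - j' / N) - b" "(t - j' / N) - b < 1 / N"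
      using f by (auto simp: frac_def a_def b_def)
    have "real j + 1 \<le> real j'" "real j' + 1 \<le> real N" using less N by linarith+
    then have s: "real j / N + 1 / N \<le> real j' / N" "real j' / N + 1 / N \<le> 1" "0 \<le> real j / N"
      using N0 by (auto simp: add_divide_distrib[symmetric] divide_right_mono)
    have "real_of_int (a - b) < 1" "0 < real_of_int (a - b)"
      using fr s unfolding of_int_diff by linarith+
    then have "a - b < 1" "0 < a - b" by (simp_all only: of_int_less_1_iff of_int_0_less_iff)
    then show False by linarith
  qed
  show ?thesis using *[of j j'] *[of j' j] assms by (metis linorder_neqE_nat)
qed

text \<open>A pigeonhole argument: the gaps of the \<open>k + 1\<close> translates are disjoint, so each
  of the \<open>k\<close> coordinates lies in the gaps of at most one translate, and some
  translate is left. Its index is the colour of \<open>y\<close>.\<close>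

lemma shift_avoiding_gaps:
  fixes y :: "nat \<Rightarrow> real" and k :: nat
  shows "\<exists>j\<le>k. \<forall>i<k. 1 / real (Suc k) \<le> frac (y i - j / real (Suc k))"
proof (rule ccontr)
  assume "\<not> ?thesis"
  then have "\<forall>j\<le>k. \<exists>i<k. frac (y i - j / real (Suc k)) < 1 / real (Suc k)"
    by (metis not_le)
  then obtain h where h: "\<And>j. j \<le> k \<Longrightarrow> h j < k \<and> frac (y (h j) - j / real (Suc k)) < 1 / real (Suc k)"
    by metis
  have "inj_on h {..k}"
  proof (rule inj_onI)
    fix j j' assume "j \<in> {..k}" "j' \<in> {..k}" "h j = h j'"
    then show "j = j'" using frac_gap_unique[of j "Suc k" j' "y (h j)"] h[of j] h[of j'] by auto
  qed
  moreover have "h ` {..k} \<subseteq> {..<k}" using h by auto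
  ultimately have "card {..k} \<le> card {..<k}" by (intro card_inj_on_le) auto
  then show False by simp
qed

lemma floor_eq_if_close:
  fixes s t \<delta> :: real
  assumes "\<delta> \<le> frac s" "\<delta> \<le> frac t" "\<bar>s - t\<bar> < \<delta>"
  shows "\<lfloor>s\<rfloor> = \<lfloor>t\<rfloor>"
proof (rule ccontr)
  have *: False if "\<lfloor>s\<rfloor> < \<lfloor>t\<rfloor>" "\<delta> \<le> frac t" "\<bar>s - t\<bar> < \<delta>" for s t
  proof -
    have "real_of_int \<lfloor>s\<rfloor> + 1 \<le> real_of_int \<lfloor>t\<rfloor>" using that(1) by linarith
    moreover have "s < \<lfloor>s\<rfloor> + 1" by linarith
    ultimately show False using that(2,3) unfolding frac_def by linarith
  qed
  assume "\<lfloor>s\<rfloor> \<noteq> \<lfloor>t\<rfloor>"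
  then consider "\<lfloor>s\<rfloor> < \<lfloor>t\<rfloor>" | "\<lfloor>t\<rfloor> < \<lfloor>s\<rfloor>" by linarith
  then show False using *[of s t] *[of t s] assms by cases (auto simp: abs_minus_commute)
qed

lemma mdist_real_space_coord: "i < k \<Longrightarrow> \<bar>x i - y i\<bar> \<le> mdist (real_space k) x y"
  unfolding mdist_real_space using member_le_L2_set[of "{..<k}" i "\<lambda>i. \<bar>x i - y i\<bar>"]
  by (simp add: L2_set_def)

lemma mdist_real_space_le: "(\<And>i. i < k \<Longrightarrow> \<bar>x i - y i\<bar> \<le> s) \<Longrightarrow> mdist (real_space k) x y \<le> k * s"
proof -
  assume "\<And>i. i < k \<Longrightarrow> \<bar>x i - y i\<bar> \<le> s"
  then have "(\<Sum>i<k. \<bar>x i - y i\<bar>) \<le> (\<Sum>i<k. s)" by (intro sum_mono) auto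
  moreover have "mdist (real_space k) x y \<le> (\<Sum>i<k. \<bar>x i - y i\<bar>)"
    unfolding mdist_real_space by (rule L2_set_le_sum_abs)
  ultimately show ?thesis by simp
qed

text \<open>The scales are chosen in this order: \<open>r\<close> so small that an \<open>r\<close>-chain
  over a set of diameter \<open>r\<close> cannot join points at distance \<open>c / 2\<close>;
  the side \<open>s\<close> of the cubes in \<open>\<real>\<^sup>k\<close> so small that their
  diameter is at most \<open>r\<close>; and the mesh \<open>1 / p\<close> of the grid so fine
  that the steps of a chain are shorter than \<open>r\<close> and their images shorter than the
  gaps \<open>s / (k + 1)\<close>.\<close>

lemma Lipschitz_light_cube_dim:
  fixes e :: "(nat \<Rightarrow> real) \<Rightarrow> 'a"
  assumes light: "Lipschitz_light X (real_space k) f"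
    and c: "0 < c"
    and mem: "\<And>x. (\<And>i. i < n \<Longrightarrow> x i \<in> {0..1}) \<Longrightarrow> e x \<in> mspace X"
    and upper: "\<And>x y \<delta>. \<lbrakk>\<And>i. i < n \<Longrightarrow> x i \<in> {0..1} \<and> y i \<in> {0..1} \<and> \<bar>x i - y i\<bar> \<le> \<delta>; 0 \<le> \<delta>\<rbrakk>
       \<Longrightarrow> mdist X (e x) (e y) \<le> c' * \<delta>"
    and lower: "\<And>x y i. \<lbrakk>\<And>i. i < n \<Longrightarrow> x i \<in> {0..1} \<and> y i \<in> {0..1}; i < n\<rbrakk>
       \<Longrightarrow> c * \<bar>x i - y i\<bar> \<le> mdist X (e x) (e y)"
  shows "n \<le> k"
proof (rule ccontr)
  assume "\<not> n \<le> k"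
  then have kn: "Suc k \<le> n" by simp
  obtain C where C: "0 < C"
    and lip: "\<forall>x\<in>mspace X. \<forall>y\<in>mspace X. mdist (real_space k) (f x) (f y) \<le> C * mdist X x y"
    and chain: "\<forall>r>0. \<forall>z l. (\<forall>i\<le>l. z i \<in> mspace X) \<longrightarrow>
      (\<forall>i<l. mdist X (z i) (z (Suc i)) \<le> r) \<longrightarrow>
      (\<forall>i\<le>l. \<forall>j\<le>l. mdist (real_space k) (f (z i)) (f (z j)) \<le> r) \<longrightarrow> mdist X (z 0) (z l) \<le> C * r"
    using light unfolding Lipschitz_light_iff_chain by (elim conjE exE) (rule that; assumption)
  define r where "r = c / (3 * C)"
  have r: "0 < r" "C * r = c / 3" using c C by (auto simp: r_def)
  define s where "s = r / Suc k"
  have s: "0 < s" "k * s \<le> r" using r by (auto simp: s_def field_simps)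
  have c'0: "0 \<le> c'"
    using upper[of "\<lambda>_. 0" "\<lambda>_. 0" 1] order_trans[OF mdist_nonneg] by fastforce
  obtain p :: nat where p: "2 \<le> p" "C * (c' * 2) < p * (s / Suc k)" "c' * 2 \<le> p * r"
  proof -
    have "0 < s / Suc k" using s(1) by simp
    then obtain N1 :: nat where N1: "C * (c' * 2) < N1 * (s / Suc k)" using reals_Archimedean3 by blast
    obtain N2 :: nat where N2: "c' * 2 < N2 * r" using reals_Archimedean3[OF r(1)] by blast
    have "N1 * (s / Suc k) \<le> (max 2 (max N1 N2)) * (s / Suc k)" "N2 * r \<le> (max 2 (max N1 N2)) * r"
      using s r by (intro mult_right_mono; simp)+
    then show ?thesis using N1 N2 by (intro that[of "max 2 (max N1 N2)"]) (simp, linarith+)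
  qed
  define g where "g z = e (\<lambda>i. z i / p)" for z :: "nat \<Rightarrow> nat"
  have unit: "real a / p \<in> {0..1}" if "a \<le> p" for a using that p(1) by auto
  have gX: "g z \<in> mspace X" if "\<forall>i<n. z i \<le> p" for z
    unfolding g_def using that unit by (intro mem) auto
  define ok where "ok j y \<longleftrightarrow> j \<le> k \<and> (\<forall>i<k. 1 / real (Suc k) \<le> frac (y i / s - j / real (Suc k)))"
    for j and y :: "nat \<Rightarrow> real"
  define col where "col z = (SOME j. ok j (f (g z)))" for z
  have col: "ok (col z) (f (g z))" for z
  proof -
    have "\<exists>j. ok j (f (g z))"
      using shift_avoiding_gaps[of k "\<lambda>i. f (g z) i / s"] unfolding ok_def by blast
    then show ?thesis unfolding col_def by (rule someI_ex)
  qed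
  obtain j z l where z: "\<forall>i\<le>l. (\<forall>j<n. z i j \<le> p) \<and> col (z i) = j"
    "\<forall>i<l. \<forall>j<n. z i j \<le> z (Suc i) j + 2 \<and> z (Suc i) j \<le> z i j + 2"
    "z 0 j = 0" "p \<le> z l j + 1" and j: "j < n"
  proof (rule hex_chain[of p n col])
    show "col x < n" for x using col[of x] kn by (auto simp: ok_def)
  qed (use p in auto)
  have zX: "g (z i) \<in> mspace X" if "i \<le> l" for i using gX z(1) that by blast
  have step: "mdist X (g (z i)) (g (z (Suc i))) \<le> c' * (2 / p)" if i: "i < l" for i
    unfolding g_def
  proof (rule upper)
    fix j assume j: "j < n"
    have "\<bar>real (z i j) - real (z (Suc i) j)\<bar> \<le> 2" using z(2) i j by force
    then have "\<bar>real (z i j) / p - real (z (Suc i) j) / p\<bar> \<le> 2 / p"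
      using p(1) by (simp add: diff_divide_distrib[symmetric] divide_right_mono)
    then show "real (z i j) / p \<in> {0..1} \<and> real (z (Suc i) j) / p \<in> {0..1} \<and>
        \<bar>real (z i j) / p - real (z (Suc i) j) / p\<bar> \<le> 2 / p"
      using unit z(1) i j by (simp add: Suc_le_eq)
  qed simp
  have fstep: "mdist (real_space k) (f (g (z i))) (f (g (z (Suc i)))) < s / Suc k" if i: "i < l" for i
  proof -
    have "mdist (real_space k) (f (g (z i))) (f (g (z (Suc i)))) \<le> C * mdist X (g (z i)) (g (z (Suc i)))"
      using lip zX[of i] zX[of "Suc i"] i by simp
    also have "\<dots> \<le> C * (c' * (2 / p))" using step[OF i] C by (intro mult_left_mono) auto
    also have "\<dots> < s / Suc k" using p by (simp add: field_simps)
    finally show ?thesis .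
  qed
  define cell where "cell i a = \<lfloor>f (g (z i)) a / s - j / real (Suc k)\<rfloor>" for i a
  have cell_step: "cell i a = cell (Suc i) a" if i: "i < l" and a: "a < k" for i a
    unfolding cell_def
  proof (rule floor_eq_if_close)
    have "ok j (f (g (z i)))" "ok j (f (g (z (Suc i))))"
      using col z(1) i by (metis less_imp_le, metis Suc_leI)
    then show "1 / real (Suc k) \<le> frac (f (g (z i)) a / s - j / real (Suc k))"
      "1 / real (Suc k) \<le> frac (f (g (z (Suc i))) a / s - j / real (Suc k))"
      using a by (auto simp: ok_def)
    have "\<bar>f (g (z i)) a - f (g (z (Suc i))) a\<bar> < s / Suc k"
      using mdist_real_space_coord[OF a] fstep[OF i] by (rule order_le_less_trans)
    then have "\<bar>f (g (z i)) a - f (g (z (Suc i))) a\<bar> / s < 1 / Suc k"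
      using s(1) by (simp add: field_simps)
    then show "\<bar>f (g (z i)) a / s - j / real (Suc k) - (f (g (z (Suc i))) a / s - j / real (Suc k))\<bar> < 1 / real (Suc k)"
      using s(1) by (simp add: diff_divide_distrib[symmetric])
  qed
  have cell0: "cell i a = cell 0 a" if "i \<le> l" "a < k" for i a
    using that by (induction i) (auto simp: cell_step[symmetric])
  have "mdist X (g (z 0)) (g (z l)) \<le> C * r"
  proof (rule chain[rule_format, OF r(1), of l "\<lambda>i. g (z i)"])
    show "mdist X (g (z i)) (g (z (Suc i))) \<le> r" if "i < l" for i
    proof -
      have "c' * (2 / p) \<le> r" using p by (simp add: field_simps)
      then show ?thesis using step[OF that] by linarith
    qed
    show "mdist (real_space k) (f (g (z i))) (f (g (z i'))) \<le> r" if i: "i \<le> l" "i' \<le> l" for i i'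
    proof -
      have "mdist (real_space k) (f (g (z i))) (f (g (z i'))) \<le> k * s"
      proof (rule mdist_real_space_le)
        fix a assume a: "a < k"
        define u v where "u = f (g (z i)) a / s - j / real (Suc k)"
          and "v = f (g (z i')) a / s - j / real (Suc k)"
        have "\<lfloor>u\<rfloor> = \<lfloor>v\<rfloor>"
          using cell0[OF i(1) a] cell0[OF i(2) a] unfolding cell_def u_def v_def by simp
        then have "\<bar>u - v\<bar> \<le> 1" by linarith
        moreover have "u - v = (f (g (z i)) a - f (g (z i')) a) / s"
          by (simp add: u_def v_def diff_divide_distrib)
        ultimately show "\<bar>f (g (z i)) a - f (g (z i')) a\<bar> \<le> s"
          using s(1) by (simp add: pos_divide_le_eq)
      qed
      then show "mdist (real_space k) (f (g (z i))) (f (g (z i'))) \<le> r" using s by linarith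
    qed
  qed (use zX in auto)
  moreover have "c * (1 / 2) \<le> c * \<bar>real (z 0 j) / p - real (z l j) / p\<bar>"
  proof (rule mult_left_mono)
    have "real p \<le> real (z l j) + 1" using z(4) by linarith
    then show "1 / 2 \<le> \<bar>real (z 0 j) / p - real (z l j) / p\<bar>"
      using z(3) p(1) by (simp add: field_simps)
  qed (use c in simp)
  moreover have "c * \<bar>real (z 0 j) / p - real (z l j) / p\<bar> \<le> mdist X (g (z 0)) (g (z l))"
    unfolding g_def using z(1) unit j by (intro lower) auto
  ultimately show False using r c by simp
qed

lemma Lipschitz_dim_eqI:
  assumes "Lipschitz_light X (real_space n) f"
    and "\<And>k g. Lipschitz_light X (real_space k) g \<Longrightarrow> n \<le> k"
  shows "Lipschitz_dim X = enat n"
  unfolding Lipschitz_dim_def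
proof (rule antisym)
  show "Inf {enat k |k. \<exists>g. Lipschitz_light X (real_space k) g} \<le> enat n"
    using assms(1) by (intro Inf_lower) blast
  show "enat n \<le> Inf {enat k |k. \<exists>g. Lipschitz_light X (real_space k) g}"
    using assms(2) by (intro Inf_greatest) auto
qed

section \<open>Metric trees\<close>

lemma mdist_refl [simp]: "x \<in> mspace m \<Longrightarrow> mdist m x x = 0"
  by simp

lemma geodesic_curve_mem:
  assumes "geodesic_curve m x y g" "0 \<le> s" "s \<le> 1"
  shows "g s \<in> mspace m"
  using assms continuous_map_funspace[of "top_of_set {0..1}" "mtopology_of m" g]
  by (auto simp: geodesic_curve_def)

text \<open>The length of the curve bounds the sum of the distances along the subdivision \<open>0 \<le> s
  \<le> t \<le> 1\<close>.\<close>

lemma geodesic_curve_additive: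
  assumes g: "geodesic_curve m x y g" and s: "0 \<le> s" "s \<le> t" "t \<le> 1"
  shows "mdist m x (g s) + mdist m (g s) (g t) + mdist m (g t) y = mdist m x y"
proof (rule antisym)
  have e: "g 0 = x" "g 1 = y" and len: "curve_length m g = ennreal (mdist m x y)"
    using g by (auto simp: geodesic_curve_def)
  let ?ts = "[0, s, t, 1]"
  have "(\<Sum>i<length ?ts - 1. ennreal (mdist m (g (?ts ! i)) (g (?ts ! Suc i)))) \<le> curve_length m g"
    unfolding curve_length_def using s by (intro SUP_upper) auto
  then have "ennreal (mdist m x (g s) + mdist m (g s) (g t) + mdist m (g t) y) \<le> ennreal (mdist m x y)"
    by (simp add: e len eval_nat_numeral add.assoc)
  then show "mdist m x (g s) + mdist m (g s) (g t) + mdist m (g t) y \<le> mdist m x y"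
    by (subst (asm) ennreal_le_iff) auto
  have "x \<in> mspace m" "y \<in> mspace m" "g s \<in> mspace m" "g t \<in> mspace m"
    using e geodesic_curve_mem[OF g] s by (force simp: e[symmetric])+
  then show "mdist m x y \<le> mdist m x (g s) + mdist m (g s) (g t) + mdist m (g t) y"
    using mdist_triangle[of x m "g s" y] mdist_triangle[of "g s" m "g t" y] by linarith
qed

lemma geodesic_curve_between:
  assumes "geodesic_curve m x y g" "u \<in> g ` {0..1}"
  shows "u \<in> mspace m" "mdist m x u + mdist m u y = mdist m x y"
proof -
  obtain s where s: "0 \<le> s" "s \<le> 1" "u = g s" using assms(2) by auto
  then show "u \<in> mspace m" using geodesic_curve_mem[OF assms(1)] by blast
  then show "mdist m x u + mdist m u y = mdist m x y"
    using geodesic_curve_additive[OF assms(1) s(1) order_refl s(2)] s(3) \<open>u \<in> mspace m\<close>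
    by simp
qed

lemma continuous_on_mdist_geodesic_curve:
  assumes "geodesic_curve m x y g" "w \<in> mspace m"
  shows "continuous_on {0..1} (\<lambda>s. mdist m w (g s))"
proof -
  have "continuous_map (top_of_set {0..1}) euclidean (\<lambda>s. mdist m w (g s))"
    using assms by (intro continuous_map_mdist) (auto simp: geodesic_curve_def)
  then show ?thesis by simp
qed

definition gromov_product :: "'a metric \<Rightarrow> 'a \<Rightarrow> 'a \<Rightarrow> 'a \<Rightarrow> real" where
  "gromov_product m b x y = (mdist m b x + mdist m b y - mdist m x y) / 2"

text \<open>The geodesic from \<open>x\<close> to \<open>z\<close> is covered by those from
  \<open>x\<close> to \<open>b\<close> and from \<open>b\<close> to \<open>z\<close>. Both
  conditions are closed, so by connectedness some point \<open>w\<close> satisfies both: it is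
  the branch point of the tripod.\<close>

lemma metric_tree_tripod:
  assumes T: "metric_tree m" and mem: "b \<in> mspace m" "x \<in> mspace m" "z \<in> mspace m"
    and c: "geodesic_curve m x z c"
  obtains w where "w \<in> c ` {0..1}" "mdist m b w = gromov_product m b x z"
proof -
  obtain g h where g: "geodesic_curve m x b g" and h: "geodesic_curve m b z h"
    using T mem unfolding metric_tree_def by metis
  have sub: "c ` {0..1} \<subseteq> g ` {0..1} \<union> h ` {0..1}"
    using T mem g h c unfolding metric_tree_def by metis
  define A where "A = {s \<in> {0..1}. mdist m x (c s) + mdist m b (c s) = mdist m x b}"
  define B where "B = {s \<in> {0..1}. mdist m b (c s) + mdist m z (c s) = mdist m b z}"
  have cont: "continuous_on {0..1} (\<lambda>s. mdist m w (c s))" if "w \<in> mspace m" for w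
    using continuous_on_mdist_geodesic_curve[OF c that] .
  have "closed A" unfolding A_def
    by (intro continuous_closed_preimage_constant continuous_intros cont mem)
  moreover have "closed B" unfolding B_def
    by (intro continuous_closed_preimage_constant continuous_intros cont mem)
  moreover have "{0..1} \<subseteq> A \<union> B"
  proof
    fix s :: real assume s: "s \<in> {0..1}"
    then have "c s \<in> g ` {0..1} \<union> h ` {0..1}" using sub by blast
    then show "s \<in> A \<union> B"
      using geodesic_curve_between[OF g, of "c s"] geodesic_curve_between[OF h, of "c s"] s
      by (auto simp: A_def B_def mdist_commute)
  qed
  moreover have "0 \<in> A" "1 \<in> B"
    using c mem by (auto simp: A_def B_def geodesic_curve_def mdist_commute)
  ultimately have "A \<inter> B \<inter> {0..1} \<noteq> {}"
    using connected_closedD[of "{0..1::real}" A B] by fastforce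
  then obtain s where s: "s \<in> A" "s \<in> B" "s \<in> {0..1}" by blast
  have "mdist m x (c s) + mdist m (c s) z = mdist m x z"
    using geodesic_curve_between(2)[OF c, of "c s"] s by blast
  then have "mdist m b (c s) = gromov_product m b x z"
    using s by (simp add: A_def B_def gromov_product_def mdist_commute field_simps)
  then show ?thesis using s by (intro that) auto
qed

lemma gromov_product_le_mdist_geodesic:
  assumes g: "geodesic_curve m x y g" and u: "u \<in> g ` {0..1}"
    and mem: "b \<in> mspace m" "x \<in> mspace m" "y \<in> mspace m"
  shows "gromov_product m b x y \<le> mdist m b u"
proof -
  have "mdist m b x \<le> mdist m b u + mdist m x u" "mdist m b y \<le> mdist m b u + mdist m u y"
    using geodesic_curve_between[OF g u] mem mdist_triangle[of b m u x] mdist_triangle[of b m u y]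
    by (auto simp: mdist_commute)
  then show ?thesis using geodesic_curve_between(2)[OF g u] by (simp add: gromov_product_def)
qed

text \<open>The Gromov product of \<open>x\<close> and \<open>z\<close> is attained as the distance from
  \<open>b\<close> to a point on the side from \<open>x\<close> to \<open>z\<close>. This point
  also lies on one of the other two sides, whose points have at least the distance of the
  corresponding product.\<close>

lemma metric_tree_hyperbolic:
  assumes T: "metric_tree m"
    and mem: "b \<in> mspace m" "x \<in> mspace m" "y \<in> mspace m" "z \<in> mspace m"
  shows "min (gromov_product m b x y) (gromov_product m b y z) \<le> gromov_product m b x z"
proof -
  obtain g h c where g: "geodesic_curve m x y g" and h: "geodesic_curve m y z h"
    and c: "geodesic_curve m x z c"
    using T mem unfolding metric_tree_def by metis
  obtain w where w: "w \<in> c ` {0..1}" "mdist m b w = gromov_product m b x z"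
    using metric_tree_tripod[OF T mem(1,2,4) c] .
  have "c ` {0..1} \<subseteq> g ` {0..1} \<union> h ` {0..1}"
    using T mem g h c unfolding metric_tree_def by metis
  then show ?thesis
    using w gromov_product_le_mdist_geodesic[OF g, of w b] gromov_product_le_mdist_geodesic[OF h, of w b] mem by fastforce
qed

text \<open>Consecutive points have Gromov product at least their mean height minus \<open>r / 2\<close>,
  and hyperbolicity propagates this lower bound along the chain without loss.\<close>

lemma metric_tree_chain:
  assumes T: "metric_tree m" and b: "b \<in> mspace m"
    and z: "\<And>i. i \<le> k \<Longrightarrow> z i \<in> mspace m"
    and step: "\<And>i. i < k \<Longrightarrow> mdist m (z i) (z (Suc i)) \<le> r"
    and height: "\<And>i. i \<le> k \<Longrightarrow> \<bar>mdist m b (z 0) - mdist m b (z i)\<bar> \<le> r"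
  shows "mdist m (z 0) (z k) \<le> 4 * r"
proof -
  have r: "0 \<le> r" using height[of 0] by simp
  have "mdist m b (z 0) - 3 / 2 * r \<le> gromov_product m b (z 0) (z i)" if "i \<le> k" for i
    using that
  proof (induction i)
    case 0
    then show ?case using z[of 0] r by (simp add: gromov_product_def)
  next
    case (Suc i)
    have "mdist m b (z 0) - 3 / 2 * r \<le> gromov_product m b (z i) (z (Suc i))"
      using height[of i] height[of "Suc i"] step[of i] Suc.prems
      by (simp add: gromov_product_def field_simps abs_le_iff)
    then show ?case
      using metric_tree_hyperbolic[OF T b z[of 0] z[of i] z[of "Suc i"]] Suc by simp
  qed
  from this[of k] show ?thesis using height[of k] by (simp add: gromov_product_def field_simps abs_le_iff)
qed

text \<open>The curve need not have constant speed; it is reparametrised by the distance from its origin,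
  which takes all intermediate values.\<close>

lemma geodesic_curve_isometric_segment:
  assumes g: "geodesic_curve m x y g"
  obtains \<gamma> where "isometric_on m {0..mdist m x y} \<gamma>"
proof -
  have e: "g 0 = x" "g 1 = y" using g by (auto simp: geodesic_curve_def)
  have x: "x \<in> mspace m" using geodesic_curve_mem[OF g, of 0] e by simp
  have "\<exists>s. 0 \<le> s \<and> s \<le> 1 \<and> mdist m x (g s) = \<tau>" if "\<tau> \<in> {0..mdist m x y}" for \<tau>
    using IVT'[of "\<lambda>s. mdist m x (g s)" 0 \<tau> 1] that x e continuous_on_mdist_geodesic_curve[OF g x] by auto
  then obtain s where s: "\<And>\<tau>. \<tau> \<in> {0..mdist m x y} \<Longrightarrow> 0 \<le> s \<tau> \<and> s \<tau> \<le> 1 \<and> mdist m x (g (s \<tau>)) = \<tau>"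
    by metis
  have *: "mdist m (g (s \<tau>)) (g (s \<sigma>)) = \<bar>\<tau> - \<sigma>\<bar>"
    if "\<tau> \<in> {0..mdist m x y}" "\<sigma> \<in> {0..mdist m x y}" "s \<tau> \<le> s \<sigma>" for \<tau> \<sigma>
  proof -
    have "mdist m x (g (s \<tau>)) + mdist m (g (s \<tau>)) (g (s \<sigma>)) + mdist m (g (s \<sigma>)) y = mdist m x y"
      using geodesic_curve_additive[OF g] s that by blast
    moreover have "mdist m x (g (s \<sigma>)) + mdist m (g (s \<sigma>)) y = mdist m x y"
      using geodesic_curve_between(2)[OF g, of "g (s \<sigma>)"] s[OF that(2)] by auto
    ultimately have "mdist m (g (s \<tau>)) (g (s \<sigma>)) = \<sigma> - \<tau>" using s that(1,2) by fastforce
    then show ?thesis using mdist_nonneg[of m "g (s \<tau>)" "g (s \<sigma>)"] by linarith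
  qed
  have "isometric_on m {0..mdist m x y} (\<lambda>\<tau>. g (s \<tau>))"
    unfolding isometric_on_def
  proof (intro conjI ballI)
    show "(\<lambda>\<tau>. g (s \<tau>)) ` {0..mdist m x y} \<subseteq> mspace m"
      using s geodesic_curve_mem[OF g] by blast
    fix \<tau> \<sigma> assume "\<tau> \<in> {0..mdist m x y}" "\<sigma> \<in> {0..mdist m x y}"
    then show "mdist m (g (s \<tau>)) (g (s \<sigma>)) = dist \<tau> \<sigma>"
      using *[of \<tau> \<sigma>] *[of \<sigma> \<tau>] by (cases "s \<tau> \<le> s \<sigma>") (auto simp: dist_real_def mdist_commute)
  qed
  then show ?thesis by (rule that)
qed

section \<open>Products of trees\<close>

lemma mdist_max_product_le_iff:
  "0 \<le> d \<Longrightarrow> mdist (max_product n T) x y \<le> d \<longleftrightarrow> (\<forall>i<n. mdist (T i) (x i) (y i) \<le> d)"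
  unfolding mdist_max_product by (subst Max_le_iff) auto

lemma mdist_max_product_coord: "i < n \<Longrightarrow> mdist (T i) (x i) (y i) \<le> mdist (max_product n T) x y"
  using mdist_max_product_le_iff[of "mdist (max_product n T) x y" n T x y] by simp

lemma max_product_trees_light:
  assumes T: "\<And>i. i < n \<Longrightarrow> metric_tree (T i) \<and> b i \<in> mspace (T i)"
  shows "Lipschitz_light (max_product n T) (real_space n)
           (\<lambda>x i. if i < n then mdist (T i) (b i) (x i) else 0)"
    (is "Lipschitz_light ?X ?Y ?f")
  unfolding Lipschitz_light_iff_chain
proof (intro conjI exI[of _ "real n + 4"] ballI allI impI)
  show "?f \<in> mspace ?X \<rightarrow> mspace ?Y" by auto
  show "0 < real n + 4" by simp
next
  fix x y assume xy: "x \<in> mspace ?X" "y \<in> mspace ?X"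
  have "mdist ?Y (?f x) (?f y) \<le> n * mdist ?X x y"
  proof (rule mdist_real_space_le)
    fix i assume i: "i < n"
    have "x i \<in> mspace (T i)" "y i \<in> mspace (T i)" using xy i by (auto simp: PiE_iff)
    then have "mdist (T i) (b i) (x i) \<le> mdist (T i) (b i) (y i) + mdist (T i) (x i) (y i)"
      "mdist (T i) (b i) (y i) \<le> mdist (T i) (b i) (x i) + mdist (T i) (x i) (y i)"
      using T[OF i] mdist_triangle[of "b i" "T i"] by (metis mdist_commute)+
    then have "\<bar>mdist (T i) (b i) (x i) - mdist (T i) (b i) (y i)\<bar> \<le> mdist (T i) (x i) (y i)"
      by linarith
    also have "\<dots> \<le> mdist ?X x y" using i by (rule mdist_max_product_coord)
    finally show "\<bar>?f x i - ?f y i\<bar> \<le> mdist ?X x y" using i by simp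
  qed
  also have "\<dots> \<le> (real n + 4) * mdist ?X x y" by (intro mult_right_mono) auto
  finally show "mdist ?Y (?f x) (?f y) \<le> (real n + 4) * mdist ?X x y" .
next
  fix r :: real and z k
  assume r: "0 < r" and z: "\<forall>i\<le>k. z i \<in> mspace ?X" "\<forall>i<k. mdist ?X (z i) (z (Suc i)) \<le> r"
    "\<forall>i\<le>k. \<forall>j\<le>k. mdist ?Y (?f (z i)) (?f (z j)) \<le> r"
  have "mdist ?X (z 0) (z k) \<le> 4 * r"
  proof (subst mdist_max_product_le_iff, use r in simp, intro allI impI)
    fix a assume a: "a < n"
    show "mdist (T a) (z 0 a) (z k a) \<le> 4 * r"
    proof (rule metric_tree_chain[where z = "\<lambda>i. z i a" and b = "b a"])
      show "z i a \<in> mspace (T a)" if "i \<le> k" for i using z(1) that a by (auto simp: PiE_iff)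
      show "mdist (T a) (z i a) (z (Suc i) a) \<le> r" if "i < k" for i
        using mdist_max_product_coord[OF a, of T "z i" "z (Suc i)"] z(2) that by fastforce
      show "\<bar>mdist (T a) (b a) (z 0 a) - mdist (T a) (b a) (z i a)\<bar> \<le> r" if "i \<le> k" for i
        using mdist_real_space_coord[OF a, of "?f (z 0)" "?f (z i)"] z(3) that a by fastforce
    qed (use T a in auto)
  qed
  also have "\<dots> \<le> (real n + 4) * r" using r by (intro mult_right_mono) auto
  finally show "mdist ?X (z 0) (z k) \<le> (real n + 4) * r" .
qed

lemma Lipschitz_dim_product_trees:
  assumes n: "1 \<le> n" and T: "\<And>i. i < n \<Longrightarrow> metric_tree (T i) \<and> nontrivial (T i)"
  shows "Lipschitz_dim (max_product n T) = enat n"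
proof -
  have "\<exists>b (L::real) \<gamma>. b \<in> mspace (T i) \<and> 0 < L \<and> isometric_on (T i) {0..L} \<gamma>" if i: "i < n" for i
  proof -
    obtain x y where xy: "x \<in> mspace (T i)" "y \<in> mspace (T i)" "x \<noteq> y"
      using T[OF i] by (auto simp: nontrivial_def)
    then obtain g where "geodesic_curve (T i) x y g" using T[OF i] unfolding metric_tree_def by blast
    then obtain \<gamma> where "isometric_on (T i) {0..mdist (T i) x y} \<gamma>"
      by (rule geodesic_curve_isometric_segment)
    moreover have "0 < mdist (T i) x y"
      using xy mdist_nonneg[of "T i" x y] mdist_zero[of x "T i" y] by linarith
    ultimately show ?thesis using xy(1) by meson
  qed
  then obtain b and L :: "nat \<Rightarrow> real" and \<gamma> where seg:
    "\<And>i. i < n \<Longrightarrow> b i \<in> mspace (T i) \<and> 0 < L i \<and> isometric_on (T i) {0..L i} (\<gamma> i)"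
    by metis
  \<comment> \<open>A cube of side \<open>l\<close> fits into the product of the segments.\<close>
  define l where "l = Min (L ` {..<n})"
  have "L ` {..<n} \<noteq> {}" using n by (simp add: lessThan_empty_iff)
  then have l: "0 < l" "\<And>i. i < n \<Longrightarrow> l \<le> L i" using seg by (auto simp: l_def Min_gr_iff)
  define e where "e x = (\<lambda>i\<in>{..<n}. \<gamma> i (l * x i))" for x :: "nat \<Rightarrow> real"
  have lx: "l * a \<in> {0..L i}" if "a \<in> {0..1}" "i < n" for a i
  proof -
    have "l * a \<le> l" using that l(1) by (simp add: mult_left_le)
    then show ?thesis using order_trans[OF _ l(2)[OF that(2)]] that l(1) by simp
  qed
  have de: "mdist (T i) (e x i) (e y i) = l * \<bar>x i - y i\<bar>" if "x i \<in> {0..1}" "y i \<in> {0..1}" "i < n" for x y i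
    using seg[OF that(3)] lx[OF that(1,3)] lx[OF that(2,3)] that(3) l(1)
    by (simp add: e_def isometric_on_def dist_real_def abs_mult right_diff_distrib[symmetric])
  show ?thesis
  proof (rule Lipschitz_dim_eqI)
    show "Lipschitz_light (max_product n T) (real_space n)
           (\<lambda>x i. if i < n then mdist (T i) (b i) (x i) else 0)"
      using T seg by (intro max_product_trees_light) blast
    fix k f assume light: "Lipschitz_light (max_product n T) (real_space k) f"
    show "n \<le> k"
    proof (rule Lipschitz_light_cube_dim[OF light l(1), of n e l])
      show "e x \<in> mspace (max_product n T)" if "\<And>i. i < n \<Longrightarrow> x i \<in> {0..1}" for x
        using lx[OF that] seg by (fastforce simp: e_def isometric_on_def)
      show "mdist (max_product n T) (e x) (e y) \<le> l * \<delta>"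
        if "\<And>i. i < n \<Longrightarrow> x i \<in> {0..1} \<and> y i \<in> {0..1} \<and> \<bar>x i - y i\<bar> \<le> \<delta>" "0 \<le> \<delta>" for x y \<delta>
        using that l(1) by (subst mdist_max_product_le_iff) (auto simp: de mult_left_mono)
      show "l * \<bar>x i - y i\<bar> \<le> mdist (max_product n T) (e x) (e y)"
        if "\<And>i. i < n \<Longrightarrow> x i \<in> {0..1} \<and> y i \<in> {0..1}" "i < n" for x y i
        using mdist_max_product_coord[OF that(2), of T "e x" "e y"] that by (simp add: de)
    qed
  qed
qed

section \<open>Comparison angles in CAT(0) spaces\<close>

definition comparison_cos :: "'a metric \<Rightarrow> 'a \<Rightarrow> 'a \<Rightarrow> 'a \<Rightarrow> real" where
  "comparison_cos m x y z =
     ((mdist m x y)\<^sup>2 + (mdist m x z)\<^sup>2 - (mdist m y z)\<^sup>2) / (2 * mdist m x y * mdist m x z)"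

lemma comparison_angle_eq: "comparison_angle m x y z = arccos (comparison_cos m x y z)"
  by (simp add: comparison_angle_def comparison_cos_def)

lemma mdist_pos: "x \<in> mspace m \<Longrightarrow> y \<in> mspace m \<Longrightarrow> y \<noteq> x \<Longrightarrow> 0 < mdist m x y"
  using mdist_nonneg[of m x y] mdist_zero[of x m y] by (auto simp: less_le)

lemma abs_comparison_cos_le_1:
  assumes mem: "x \<in> mspace m" "y \<in> mspace m" "z \<in> mspace m" and ne: "y \<noteq> x" "z \<noteq> x"
  shows "\<bar>comparison_cos m x y z\<bar> \<le> 1"
proof -
  define a b c where "a = mdist m x y" and "b = mdist m x z" and "c = mdist m y z"
  have ab: "0 < a" "0 < b" "0 \<le> c" using mdist_pos mem ne by (auto simp: a_def b_def c_def)
  have tri: "c \<le> a + b" "a \<le> b + c" "b \<le> a + c"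
    using mdist_triangle[of y m x z] mdist_triangle[of x m z y] mdist_triangle[of x m y z] mem
    by (auto simp: a_def b_def c_def mdist_commute)
  have "c\<^sup>2 \<le> (a + b)\<^sup>2" "\<bar>a - b\<bar>\<^sup>2 \<le> c\<^sup>2" using tri ab by (intro power_mono; linarith)+
  then have "a\<^sup>2 + b\<^sup>2 - c\<^sup>2 \<le> 2 * a * b" "- (2 * a * b) \<le> a\<^sup>2 + b\<^sup>2 - c\<^sup>2"
    by (simp_all add: power2_sum power2_diff)
  then have "\<bar>(a\<^sup>2 + b\<^sup>2 - c\<^sup>2) / (2 * a * b)\<bar> \<le> 1"
    using ab by (simp add: abs_le_iff pos_divide_le_eq)
  then show ?thesis by (simp add: comparison_cos_def a_def b_def c_def)
qed

lemma dist_vector_2: "dist (vector [a, b] :: real^2) (vector [c, d]) = sqrt ((a - c)\<^sup>2 + (b - d)\<^sup>2)"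
  by (simp add: dist_vec_def L2_set_def sum_2 dist_real_def)

text \<open>The comparison triangle, put in coordinates: \<open>x\<close> at the origin, \<open>y\<close>
  on the first axis, and \<open>z\<close> at the polar angle with cosine \<open>\<kappa>\<close>
  and sine \<open>\<sigma>\<close>.\<close>

lemma CAT0_law_of_cosines:
  assumes C: "CAT0 m" and mem: "x \<in> mspace m" "y \<in> mspace m" "z \<in> mspace m"
    and ne: "y \<noteq> x" "z \<noteq> x"
    and g: "geodesic_segment m x y g" and h: "geodesic_segment m x z h"
    and s: "0 \<le> s" "s \<le> mdist m x y" and t: "0 \<le> t" "t \<le> mdist m x z"
  shows "(mdist m (g s) (h t))\<^sup>2 \<le> s\<^sup>2 + t\<^sup>2 - 2 * s * t * comparison_cos m x y z"
proof -
  define A B D where "A = mdist m x y" and "B = mdist m x z" and "D = mdist m y z"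
  define \<kappa> \<sigma> where "\<kappa> = comparison_cos m x y z" and "\<sigma> = sqrt (1 - \<kappa>\<^sup>2)"
  have AB: "0 < A" "0 < B" "0 \<le> D" using mdist_pos mem ne by (auto simp: A_def B_def D_def)
  have "\<kappa>\<^sup>2 \<le> 1"
    using abs_comparison_cos_le_1[OF mem ne] by (simp add: \<kappa>_def abs_square_le_1)
  then have \<sigma>: "\<sigma>\<^sup>2 = 1 - \<kappa>\<^sup>2" by (simp add: \<sigma>_def)
  have polar: "(a - b * \<kappa>)\<^sup>2 + (b * \<sigma>)\<^sup>2 = a\<^sup>2 + b\<^sup>2 - 2 * a * b * \<kappa>" for a b
  proof -
    have "(a - b * \<kappa>)\<^sup>2 + (b * \<sigma>)\<^sup>2 = a\<^sup>2 - 2 * a * b * \<kappa> + b\<^sup>2 * \<kappa>\<^sup>2 + b\<^sup>2 * \<sigma>\<^sup>2"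
      by (simp add: power2_diff power_mult_distrib)
    also have "\<dots> = a\<^sup>2 + b\<^sup>2 - 2 * a * b * \<kappa>" unfolding \<sigma> by (simp add: algebra_simps)
    finally show ?thesis .
  qed
  have \<kappa>: "2 * A * B * \<kappa> = A\<^sup>2 + B\<^sup>2 - D\<^sup>2"
    using AB by (simp add: \<kappa>_def comparison_cos_def A_def B_def D_def)
  define x' y' z' p' q' :: "real^2" where "x' = vector [0, 0]" and "y' = vector [A, 0]"
    and "z' = vector [B * \<kappa>, B * \<sigma>]" and "p' = vector [s, 0]" and "q' = vector [t * \<kappa>, t * \<sigma>]"
  have norm1: "(b * \<kappa>)\<^sup>2 + (b * \<sigma>)\<^sup>2 = b\<^sup>2" for b using polar[of 0 b] by simp
  have "dist x' y' = A" "dist x' z' = B" "dist x' p' = s" "dist x' q' = t"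
    using AB s t by (simp_all add: x'_def y'_def z'_def p'_def q'_def dist_vector_2 norm1)
  moreover have "dist y' z' = D"
    using AB by (simp add: y'_def z'_def dist_vector_2 polar \<kappa>)
  moreover have "p' \<in> closed_segment x' y'"
    unfolding in_segment using s AB
    by (intro exI[of _ "s / A"]) (simp add: A_def[symmetric] x'_def y'_def p'_def vec_eq_iff forall_2)
  moreover have "q' \<in> closed_segment x' z'"
    unfolding in_segment using t AB
    by (intro exI[of _ "t / B"]) (simp add: B_def[symmetric] x'_def z'_def q'_def vec_eq_iff forall_2)
  ultimately have "mdist m (g s) (h t) \<le> dist p' q'"
    using C mem g h s t unfolding CAT0_def A_def B_def D_def by (metis atLeastAtMost_iff)
  then have "(mdist m (g s) (h t))\<^sup>2 \<le> (dist p' q')\<^sup>2" by (intro power_mono) auto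
  also have "\<dots> = s\<^sup>2 + t\<^sup>2 - 2 * s * t * \<kappa>"
    unfolding polar[symmetric] by (simp add: p'_def q'_def dist_vector_2)
  finally show ?thesis by (simp add: \<kappa>_def)
qed

lemma geodesic_segment_dist:
  assumes g: "geodesic_segment m x y g" and s: "0 \<le> s" "s \<le> mdist m x y"
  shows "g s \<in> mspace m" "mdist m x (g s) = s"
proof -
  show "g s \<in> mspace m" using g s by (auto simp: geodesic_segment_def isometric_on_def)
  have "mdist m (g 0) (g s) = dist 0 s"
    using g s unfolding geodesic_segment_def isometric_on_def by (meson atLeastAtMost_iff order_refl order_trans)
  then show "mdist m x (g s) = s" using g s by (simp add: geodesic_segment_def)
qed

lemma geodesic_segment_initial:
  assumes g: "geodesic_segment m x y g" and s: "0 \<le> s" "s \<le> mdist m x y"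
  shows "geodesic_segment m x (g s) g"
  unfolding geodesic_segment_def geodesic_segment_dist(2)[OF g s]
proof (intro conjI refl)
  show "g 0 = x" using g by (simp add: geodesic_segment_def)
  have "{0..s} \<subseteq> {0..mdist m x y}" using s by auto
  then show "isometric_on m {0..s} g"
    using g unfolding geodesic_segment_def isometric_on_def by (meson image_mono order_trans subsetD)
qed

text \<open>The extended real under the coercion in \<^const>\<open>Alexandrov_angle\<close>.\<close>

definition angle_limsup :: "'a metric \<Rightarrow> (real \<Rightarrow> 'a) \<Rightarrow> (real \<Rightarrow> 'a) \<Rightarrow> ereal" where
  "angle_limsup m g h = Limsup (at_right 0 \<times>\<^sub>F at_right 0)
     (\<lambda>(s, t). ereal (comparison_angle m (g 0) (g s) (h t)))"

lemma angle_limsup_bounds: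
  assumes C: "CAT0 m" and mem: "x \<in> mspace m" "y \<in> mspace m" "z \<in> mspace m"
    and ne: "y \<noteq> x" "z \<noteq> x"
    and g: "geodesic_segment m x y g" and h: "geodesic_segment m x z h"
  shows "0 \<le> angle_limsup m g h" "angle_limsup m g h \<le> ereal (comparison_angle m x y z)"
proof -
  define A B where "A = mdist m x y" and "B = mdist m x z"
  have AB: "0 < A" "0 < B" using mdist_pos mem ne by (auto simp: A_def B_def)
  have g0: "g 0 = x" using g by (simp add: geodesic_segment_def)
  have bnd: "0 \<le> comparison_angle m (g 0) (g s) (h t) \<and>
      comparison_angle m (g 0) (g s) (h t) \<le> comparison_angle m x y z"
    if s: "s \<in> {0<..<A}" and t: "t \<in> {0<..<B}" for s t
  proof -
    have gs: "g s \<in> mspace m" "mdist m x (g s) = s" using geodesic_segment_dist[OF g] s by (auto simp: A_def)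
    have ht: "h t \<in> mspace m" "mdist m x (h t) = t" using geodesic_segment_dist[OF h] t by (auto simp: B_def)
    have "g s \<noteq> x" "h t \<noteq> x" using gs ht s t mem by auto
    then have 1: "\<bar>comparison_cos m x (g s) (h t)\<bar> \<le> 1"
      by (intro abs_comparison_cos_le_1 mem gs ht)
    have "(mdist m (g s) (h t))\<^sup>2 \<le> s\<^sup>2 + t\<^sup>2 - 2 * s * t * comparison_cos m x y z"
      using CAT0_law_of_cosines[OF C mem ne g h] s t by (auto simp: A_def B_def)
    then have "comparison_cos m x y z \<le> comparison_cos m x (g s) (h t)"
      using s t unfolding comparison_cos_def[of m x "g s"] gs ht by (simp add: field_simps)
    then show ?thesis
      using 1 abs_comparison_cos_le_1[OF mem ne] unfolding comparison_angle_eq g0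
      by (auto intro!: arccos_lbound arccos_le_arccos)
  qed
  have ev: "eventually (\<lambda>p. fst p \<in> {0<..<A} \<and> snd p \<in> {0<..<B}) (at_right (0::real) \<times>\<^sub>F at_right (0::real))"
    unfolding eventually_prod_filter
    using eventually_at_right_real[OF AB(1)] eventually_at_right_real[OF AB(2)] by auto
  show "angle_limsup m g h \<le> ereal (comparison_angle m x y z)"
    unfolding angle_limsup_def
    by (rule Limsup_bounded, rule eventually_mono[OF ev]) (use bnd in auto)
  show "0 \<le> angle_limsup m g h"
    unfolding angle_limsup_def
    by (rule le_Limsup, simp add: prod_filter_eq_bot, rule eventually_mono[OF ev]) (use bnd in auto)
qed

lemma Alexandrov_angle_bounds:
  assumes "CAT0 m" "x \<in> mspace m" "y \<in> mspace m" "z \<in> mspace m" "y \<noteq> x" "z \<noteq> x"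
    "geodesic_segment m x y g" "geodesic_segment m x z h"
  shows "angle_limsup m g h = ereal (Alexandrov_angle m g h)"
    "0 \<le> Alexandrov_angle m g h" "Alexandrov_angle m g h \<le> pi"
    "comparison_cos m x y z \<le> cos (Alexandrov_angle m g h)"
proof -
  note b = angle_limsup_bounds[OF assms]
  have c: "\<bar>comparison_cos m x y z\<bar> \<le> 1" using assms by (intro abs_comparison_cos_le_1)
  have "\<bar>angle_limsup m g h\<bar> \<noteq> \<infinity>" using b by (cases "angle_limsup m g h") auto
  then show e: "angle_limsup m g h = ereal (Alexandrov_angle m g h)"
    unfolding Alexandrov_angle_def angle_limsup_def[symmetric] by (simp add: ereal_real)
  have l: "0 \<le> Alexandrov_angle m g h" "Alexandrov_angle m g h \<le> arccos (comparison_cos m x y z)"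
    using b unfolding e comparison_angle_eq by auto
  then show "0 \<le> Alexandrov_angle m g h" by simp
  have u: "arccos (comparison_cos m x y z) \<le> pi" using c by (intro arccos_ubound) auto
  then show "Alexandrov_angle m g h \<le> pi" using l by linarith
  have "cos (arccos (comparison_cos m x y z)) \<le> cos (Alexandrov_angle m g h)"
    using l u by (intro cos_monotone_0_pi_le) auto
  then show "comparison_cos m x y z \<le> cos (Alexandrov_angle m g h)" using c by simp
qed

text \<open>Angles are used through the chords \<open>mdist m (g s) (h s)\<close>, whose length relative
  to \<open>s\<close> is asymptotically \<open>2 sin (\<alpha> / 2)\<close>. This bound and the
  next one convert between the two; the triangle inequality for chords then replaces the one for
  angles.\<close>

lemma chord_ge_Alexandrov:
  assumes C: "CAT0 m" and mem: "x \<in> mspace m" "y \<in> mspace m" "z \<in> mspace m"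
    and ne: "y \<noteq> x" "z \<noteq> x"
    and g: "geodesic_segment m x y g" and h: "geodesic_segment m x z h"
    and s: "0 \<le> s" "s \<le> mdist m x y" "s \<le> mdist m x z"
  shows "s\<^sup>2 * (2 - 2 * cos (Alexandrov_angle m g h)) \<le> (mdist m (g s) (h s))\<^sup>2"
proof (cases "s = 0")
  case False
  have gs: "g s \<in> mspace m" "mdist m x (g s) = s" using geodesic_segment_dist[OF g] s by auto
  have hs: "h s \<in> mspace m" "mdist m x (h s) = s" using geodesic_segment_dist[OF h] s by auto
  have "g s \<noteq> x" "h s \<noteq> x" using gs hs s mem False by auto
  then have "comparison_cos m x (g s) (h s) \<le> cos (Alexandrov_angle m g h)"
    using geodesic_segment_initial[OF g] geodesic_segment_initial[OF h] s
    by (intro Alexandrov_angle_bounds(4)[OF C mem(1) gs(1) hs(1)]) auto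
  then show ?thesis
    using False s unfolding comparison_cos_def gs hs by (simp add: field_simps power2_eq_square)
qed simp

text \<open>The angle is an upper limit over all pairs of parameters, so it dominates the diagonal pairs
  \<open>(s, s)\<close>.\<close>

lemma cos_Alexandrov_le:
  assumes C: "CAT0 m" and mem: "x \<in> mspace m" "y \<in> mspace m" "z \<in> mspace m"
    and ne: "y \<noteq> x" "z \<noteq> x"
    and g: "geodesic_segment m x y g" and h: "geodesic_segment m x z h"
    and \<kappa>: "0 \<le> \<kappa>" "\<kappa> \<le> 2" and \<delta>: "0 < \<delta>"
    and chord: "\<And>s. 0 < s \<Longrightarrow> s < \<delta> \<Longrightarrow> \<kappa> * s \<le> mdist m (g s) (h s)"
  shows "cos (Alexandrov_angle m g h) \<le> 1 - \<kappa>\<^sup>2 / 2"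
proof (rule ccontr)
  note b = Alexandrov_angle_bounds[OF C mem ne g h]
  assume "\<not> ?thesis"
  then have lt: "1 - \<kappa>\<^sup>2 / 2 < cos (Alexandrov_angle m g h)" by simp
  have "\<kappa>\<^sup>2 \<le> 2\<^sup>2" using \<kappa> by (intro power_mono) auto
  then have r: "- 1 \<le> 1 - \<kappa>\<^sup>2 / 2" by simp
  have "arccos (cos (Alexandrov_angle m g h)) < arccos (1 - \<kappa>\<^sup>2 / 2)"
    using lt r by (intro arccos_less_arccos) auto
  then have "angle_limsup m g h < ereal (arccos (1 - \<kappa>\<^sup>2 / 2))"
    using b by (simp add: arccos_cos)
  then have "eventually (\<lambda>(s, t). ereal (comparison_angle m (g 0) (g s) (h t)) < ereal (arccos (1 - \<kappa>\<^sup>2 / 2)))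
      (at_right 0 \<times>\<^sub>F at_right 0)"
    unfolding angle_limsup_def by (drule_tac Limsup_lessD) (simp add: case_prod_unfold)
  then obtain Q where Q: "eventually Q (at_right (0::real))"
    "\<And>s t. Q s \<Longrightarrow> Q t \<Longrightarrow> comparison_angle m (g 0) (g s) (h t) < arccos (1 - \<kappa>\<^sup>2 / 2)"
    unfolding eventually_prod_same by auto
  define A B where "A = mdist m x y" and "B = mdist m x z"
  have AB: "0 < min \<delta> (min A B)" using mdist_pos mem ne \<delta> by (auto simp: A_def B_def)
  have "eventually (\<lambda>s. Q s \<and> s \<in> {0<..<min \<delta> (min A B)}) (at_right 0)"
    using Q(1) eventually_at_right_real[OF AB] by (rule eventually_conj)
  then obtain s where s: "Q s" "s \<in> {0<..<min \<delta> (min A B)}"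
    using eventually_happens'[of "at_right (0::real)"] by fastforce
  have gs: "g s \<in> mspace m" "mdist m x (g s) = s" using geodesic_segment_dist[OF g] s by (auto simp: A_def)
  have hs: "h s \<in> mspace m" "mdist m x (h s) = s" using geodesic_segment_dist[OF h] s by (auto simp: B_def)
  have nes: "g s \<noteq> x" "h s \<noteq> x" using gs hs s mem by auto
  have g0: "g 0 = x" using g by (simp add: geodesic_segment_def)
  have "arccos (comparison_cos m x (g s) (h s)) < arccos (1 - \<kappa>\<^sup>2 / 2)"
    using Q(2)[OF s(1) s(1)] by (simp add: g0 comparison_angle_eq)
  moreover have "\<bar>comparison_cos m x (g s) (h s)\<bar> \<le> 1" "\<bar>1 - \<kappa>\<^sup>2 / 2\<bar> \<le> 1"
    using abs_comparison_cos_le_1[OF mem(1) gs(1) hs(1) nes] r by (auto simp: abs_le_iff)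
  ultimately have "1 - \<kappa>\<^sup>2 / 2 < comparison_cos m x (g s) (h s)" using arccos_less_mono by blast
  then have "(mdist m (g s) (h s))\<^sup>2 < (\<kappa> * s)\<^sup>2"
    using s unfolding comparison_cos_def gs hs by (simp add: field_simps power2_eq_square)
  moreover have "(\<kappa> * s)\<^sup>2 \<le> (mdist m (g s) (h s))\<^sup>2"
    using chord[of s] s \<kappa> by (intro power_mono) auto
  ultimately show False by simp
qed

section \<open>Finite reflection groups and regular directions\<close>

text \<open>Since \<open>g v = L v + g 0\<close> with \<open>L\<close> invertible, the inverse of
  \<open>g\<close> is affine with linear part \<open>inv L\<close>.\<close>

lemma affine_inverse_linear_part:
  fixes g :: "'e::euclidean_space \<Rightarrow> 'e"
  assumes L: "orthogonal_transformation (\<lambda>v. g v - g 0)"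
  shows "(\<lambda>v. inv g v - inv g 0) = inv (\<lambda>v. g v - g 0)"
proof -
  define L where "L v = g v - g 0" for v
  have oL: "orthogonal_transformation L" using L by (simp add: L_def[abs_def])
  have "bij L" using oL by (rule orthogonal_transformation_bij)
  have "inj g"
  proof (rule injI)
    fix x y assume "g x = g y"
    then have "L x = L y" by (simp add: L_def)
    then show "x = y" using \<open>bij L\<close> by (simp add: bij_is_inj inj_eq)
  qed
  have LL: "L (inv L v) = v" for v using \<open>bij L\<close> by (simp add: bij_is_surj surj_f_inv_f)
  have "surj g"
    unfolding surj_def
  proof
    fix y show "\<exists>x. y = g x"
      using LL[of "y - g 0"] by (intro exI[of _ "inv L (y - g 0)"]) (simp add: L_def)
  qed
  have "inv g v = inv L v + inv g 0" for v
  proof -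
    have "L (inv L v + inv g 0) = v + L (inv g 0)"
      using oL by (simp add: orthogonal_transformation_linear linear_add LL)
    then have "g (inv L v + inv g 0) = v" using \<open>surj g\<close> by (simp add: L_def surj_f_inv_f)
    then show ?thesis using \<open>inj g\<close> by (metis inv_f_f)
  qed
  then have "inv g v - inv g 0 = inv L v" for v by (metis add_diff_cancel_right')
  then show ?thesis unfolding L_def by (rule ext)
qed

lemma hyperplane_reflection_orthogonal:
  assumes "a \<noteq> 0"
  shows "orthogonal_transformation (\<lambda>v. hyperplane_reflection a b v - hyperplane_reflection a b 0)"
proof -
  define c where "c v = 2 * (a \<bullet> v) / (a \<bullet> a)" for v
  have c_diff: "2 * (a \<bullet> v - b) / (a \<bullet> a) - 2 * (a \<bullet> 0 - b) / (a \<bullet> a) = c v" for v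
    by (simp add: c_def add_divide_distrib[symmetric])
  have e: "hyperplane_reflection a b v - hyperplane_reflection a b 0 = v - c v *\<^sub>R a" for v
  proof -
    have "hyperplane_reflection a b v - hyperplane_reflection a b 0 =
        v - ((2 * (a \<bullet> v - b) / (a \<bullet> a)) *\<^sub>R a - (2 * (a \<bullet> 0 - b) / (a \<bullet> a)) *\<^sub>R a)"
      by (simp add: hyperplane_reflection_def)
    then show ?thesis by (simp only: scaleR_diff_left[symmetric] c_diff)
  qed
  have add: "c (v + w) = c v + c w" and scale: "c (r *\<^sub>R v) = r * c v" for v w r
    by (simp_all add: c_def inner_add_right distrib_left add_divide_distrib)
  have ca: "c v * (a \<bullet> a) = 2 * (a \<bullet> v)" for v using assms by (simp add: c_def)
  show ?thesis
    unfolding e orthogonal_transformation_def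
  proof (intro conjI allI)
    show "linear (\<lambda>v. v - c v *\<^sub>R a)"
      by (rule linearI) (simp_all add: add scale scaleR_add_left scaleR_diff_right)
    fix v w
    have "(v - c v *\<^sub>R a) \<bullet> (w - c w *\<^sub>R a) =
        v \<bullet> w - c w * (a \<bullet> v) - c v * (a \<bullet> w) + c w * (c v * (a \<bullet> a))"
      by (simp add: inner_diff_left inner_diff_right inner_commute)
    also have "\<dots> = v \<bullet> w + c w * (a \<bullet> v) - c v * (a \<bullet> w)" by (simp add: ca)
    also have "\<dots> = v \<bullet> w" by (simp add: c_def)
    finally show "(v - c v *\<^sub>R a) \<bullet> (w - c w *\<^sub>R a) = v \<bullet> w" .
  qed
qed

lemma generated_group_orthogonal:
  assumes R: "R \<subseteq> {hyperplane_reflection a b |a b. a \<noteq> 0}" and g: "g \<in> generated_group R"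
  shows "orthogonal_transformation (\<lambda>v. g v - g 0 :: 'e::euclidean_space)"
  using g
proof induction
  case 1
  have "(\<lambda>v :: 'e. id v - id 0) = (\<lambda>v. v)" by auto
  then show ?case by (simp add: orthogonal_transformation_id)
next
  case (2 g)
  then show ?case using R hyperplane_reflection_orthogonal by blast
next
  case (3 g h)
  have "(\<lambda>v. (g \<circ> h) v - (g \<circ> h) 0) = (\<lambda>v. g v - g 0) \<circ> (\<lambda>v. h v - h 0)"
  proof
    fix v
    have "linear (\<lambda>v. g v - g 0)" using 3 by (simp add: orthogonal_transformation_linear)
    from linear_diff[OF this, of "h v" "h 0"]
    show "(g \<circ> h) v - (g \<circ> h) 0 = ((\<lambda>v. g v - g 0) \<circ> (\<lambda>v. h v - h 0)) v" by simp
  qed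
  then show ?case using 3 by (simp add: orthogonal_transformation_compose)
next
  case (4 g)
  then show ?case by (simp add: affine_inverse_linear_part orthogonal_transformation_inv)
qed

lemma affine_reflection_group_linear_parts:
  assumes G: "affine_reflection_group (G :: ('e::euclidean_space \<Rightarrow> 'e) set)"
  shows "finite (linear_parts G)" "w \<in> linear_parts G \<Longrightarrow> orthogonal_transformation w"
    "id \<in> linear_parts G"
    "\<lbrakk>w \<in> linear_parts G; w' \<in> linear_parts G\<rbrakk> \<Longrightarrow> w \<circ> w' \<in> linear_parts G"
    "w \<in> linear_parts G \<Longrightarrow> inv w \<in> linear_parts G"
proof -
  show "finite (linear_parts G)" using G by (simp add: affine_reflection_group_def)
  obtain R where R: "R \<subseteq> {hyperplane_reflection a b |a b. a \<noteq> 0}" and GR: "G = generated_group R"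
    using G by (auto simp: affine_reflection_group_def)
  have orth: "orthogonal_transformation (\<lambda>v. g v - g 0)" if "g \<in> G" for g
    using generated_group_orthogonal[OF R] that GR by blast
  show "orthogonal_transformation w" if "w \<in> linear_parts G" for w
    using that orth by (auto simp: linear_parts_def)
  have "id \<in> G" unfolding GR by (rule generated_group.intros)
  then show "id \<in> linear_parts G" unfolding linear_parts_def
    by (intro image_eqI[of _ _ id]) auto
  show "w \<circ> w' \<in> linear_parts G" if w: "w \<in> linear_parts G" "w' \<in> linear_parts G" for w w'
  proof -
    obtain g h where g: "g \<in> G" "w = (\<lambda>v. g v - g 0)" and h: "h \<in> G" "w' = (\<lambda>v. h v - h 0)"
      using w by (auto simp: linear_parts_def)
    have "linear w" using orth[OF g(1)] g(2) by (simp add: orthogonal_transformation_linear)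
    then have "w (h v - h 0) = g (h v) - g (h 0)" for v
      using linear_diff[of w "h v" "h 0"] by (simp add: g(2))
    then have "w \<circ> w' = (\<lambda>v. (g \<circ> h) v - (g \<circ> h) 0)" by (auto simp: h(2))
    moreover have "g \<circ> h \<in> G" using g(1) h(1) unfolding GR by (rule generated_group.intros)
    ultimately show ?thesis unfolding linear_parts_def by (rule image_eqI)
  qed
  show "inv w \<in> linear_parts G" if w: "w \<in> linear_parts G" for w
  proof -
    obtain g where g: "g \<in> G" "w = (\<lambda>v. g v - g 0)" using w by (auto simp: linear_parts_def)
    have "inv w = (\<lambda>v. inv g v - inv g 0)"
      unfolding g(2) using affine_inverse_linear_part[OF orth[OF g(1)]] by simp
    moreover have "inv g \<in> G" using g(1) unfolding GR by (rule generated_group.intros)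
    ultimately show ?thesis unfolding linear_parts_def by (rule image_eqI)
  qed
qed

text \<open>The fixed spaces of the nontrivial elements of \<open>W\<close> are proper subspaces, so
  finitely many of them do not cover the space. A vector \<open>u\<close> outside is moved by
  each \<open>w\<close> by a definite amount, and \<open>\<rho>\<close> is at most a quarter of
  the least one; then a vector close to \<open>u\<close> is at least as close to another such
  vector as to the rest of its orbit.\<close>

lemma exists_regular_direction:
  fixes W :: "('e::euclidean_space \<Rightarrow> 'e) set"
  assumes fin: "finite W" and orth: "\<And>w. w \<in> W \<Longrightarrow> orthogonal_transformation w"
  obtains u \<rho> where "norm u = 1" "0 < \<rho>" "\<rho> \<le> 1"
    "\<And>w v v'. \<lbrakk>w \<in> W; norm (v - u) \<le> \<rho>; norm (v' - u) \<le> \<rho>\<rbrakk> \<Longrightarrow> norm (v - v') \<le> norm (v - w v')"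
proof -
  have "negligible {v. w v = v}" if w: "w \<in> W" "w \<noteq> id" for w
  proof (rule negligible_lowdim)
    have lin: "linear w" using orth[OF w(1)] by (rule orthogonal_transformation_linear)
    have "subspace {v. w v = v}"
      using lin by (auto simp: subspace_def linear_add linear_cmul linear_0)
    moreover have "{v. w v = v} \<noteq> UNIV" using w(2) by (auto simp: fun_eq_iff)
    ultimately have "dim {v. w v = v} \<noteq> DIM('e)" by (metis dim_eq_full span_eq_iff)
    then show "dim {v. w v = v} < DIM('e)" using dim_subset_UNIV[of "{v. w v = v}"] by linarith
  qed
  then have "negligible (\<Union> ((\<lambda>w. {v. w v = v}) ` (W - {id})))"
    using fin by (intro negligible_Union) auto
  then have "negligible ({0} \<union> \<Union> ((\<lambda>w. {v. w v = v}) ` (W - {id})))" by (simp add: negligible_Un)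
  then have "{0} \<union> \<Union> ((\<lambda>w. {v. w v = v}) ` (W - {id})) \<noteq> UNIV" by (metis non_negligible_UNIV)
  then obtain v where v: "v \<noteq> 0" "\<And>w. w \<in> W \<Longrightarrow> w \<noteq> id \<Longrightarrow> w v \<noteq> v" by blast
  define u where "u = sgn v"
  have u: "norm u = 1" using v(1) by (simp add: u_def norm_sgn)
  have wu: "w u \<noteq> u" if "w \<in> W" "w \<noteq> id" for w
  proof
    assume "w u = u"
    have "linear w" using orth[OF that(1)] by (rule orthogonal_transformation_linear)
    moreover have "v = norm v *\<^sub>R u" using v(1) by (simp add: u_def sgn_div_norm)
    ultimately have "w v = v" using \<open>w u = u\<close> by (metis linear_cmul)
    then show False using v that by blast
  qed
  define \<rho> where "\<rho> = Min (insert 4 ((\<lambda>w. norm (w u - u)) ` (W - {id}))) / 4"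
  have \<rho>: "0 < \<rho>" "\<rho> \<le> 1" "\<And>w. w \<in> W \<Longrightarrow> w \<noteq> id \<Longrightarrow> 4 * \<rho> \<le> norm (w u - u)"
    using fin wu by (auto simp: \<rho>_def)
  show ?thesis
  proof (rule that[OF u \<rho>(1,2)])
    fix w v v' assume w: "w \<in> W" and v: "norm (v - u) \<le> \<rho>" "norm (v' - u) \<le> \<rho>"
    show "norm (v - v') \<le> norm (v - w v')"
    proof (cases "w = id")
      case False
      have "norm (w v' - w u) = norm (v' - u)"
      proof -
        have "w v' - w u = w (v' - u)"
          using linear_diff[OF orthogonal_transformation_linear[OF orth[OF w]]] by simp
        then show ?thesis using orthogonal_transformation_norm[OF orth[OF w]] by simp
      qed
      moreover have "norm (w u - u) \<le> norm (w v' - w u) + norm (v - w v') + norm (v - u)"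
        using norm_triangle_ineq[of "w u - w v'" "w v' - u"] norm_triangle_ineq[of "w v' - v" "v - u"]
        by (simp add: norm_minus_commute)
      moreover have "norm (v - v') \<le> norm (v - u) + norm (v' - u)"
        using norm_triangle_ineq[of "v - u" "u - v'"] by (simp add: norm_minus_commute)
      ultimately show ?thesis using v \<rho>(3)[OF w False] by linarith
    qed simp
  qed
qed

section \<open>Directions in a Euclidean building\<close>

context euclidean_building
begin

abbreviation "W \<equiv> linear_parts Waff"

lemmas W_finite = affine_reflection_group_linear_parts(1)[OF reflection_group]
  and W_orthogonal = affine_reflection_group_linear_parts(2)[OF reflection_group]
  and W_id = affine_reflection_group_linear_parts(3)[OF reflection_group]
  and W_comp = affine_reflection_group_linear_parts(4)[OF reflection_group]
  and W_inv = affine_reflection_group_linear_parts(5)[OF reflection_group]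

lemma W_linear: "w \<in> W \<Longrightarrow> linear w"
  using W_orthogonal by (blast intro: orthogonal_transformation_linear)

lemma W_norm: "w \<in> W \<Longrightarrow> norm (w v) = norm v"
  using W_orthogonal by (blast intro: orthogonal_transformation_norm)

lemma W_inner: "w \<in> W \<Longrightarrow> w u \<bullet> w v = u \<bullet> v"
  using W_orthogonal by (simp add: orthogonal_transformation_def)

lemma W_neg: "w \<in> W \<Longrightarrow> w (- v) = - w v"
  using W_linear by (rule linear_neg)

lemma W_inv_left: "w \<in> W \<Longrightarrow> inv w (w v) = v"
  using W_orthogonal orthogonal_transformation_inj by (metis inv_f_f)

lemma W_inv_right: "w \<in> W \<Longrightarrow> w (inv w v) = v"
  using W_orthogonal orthogonal_transformation_surj by (metis surj_f_inv_f)

lemma direction_class_eq: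
  assumes "a \<in> direction_class W u"
  shows "direction_class W a = direction_class W u"
proof -
  obtain w where w: "w \<in> W" "a = w u" using assms by (auto simp: direction_class_def)
  have "w' a \<in> direction_class W u" if "w' \<in> W" for w'
    using W_comp[OF that w(1)] w(2) unfolding direction_class_def by (metis comp_apply image_eqI)
  moreover have "w' u \<in> direction_class W a" if "w' \<in> W" for w'
    using W_comp[OF that W_inv[OF w(1)]] W_inv_left[OF w(1)] w(2)
    unfolding direction_class_def by (metis comp_apply image_eqI)
  ultimately show ?thesis unfolding direction_class_def by blast
qed

lemma direction_class_refl: "u \<in> direction_class W u"
  unfolding direction_class_def using W_id by (intro image_eqI[of _ _ id]) auto

lemma segment_in_chart:
  assumes "x \<in> mspace X" "y \<in> mspace X"
  obtains \<iota> p q where "\<iota> \<in> charts" "x = \<iota> p" "y = \<iota> q"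
proof -
  obtain g where g: "geodesic_segment X x y g" using CAT0 assms unfolding CAT0_def by blast
  then have "isometric_on X {0..mdist X x y} g" by (simp add: geodesic_segment_def)
  then obtain \<iota> where \<iota>: "\<iota> \<in> charts" "g ` {0..mdist X x y} \<subseteq> range \<iota>"
    using chart_geodesic[of "{0..mdist X x y}" g] mdist_nonneg[of X x y] by blast
  have "x \<in> g ` {0..mdist X x y}" "y \<in> g ` {0..mdist X x y}"
    using g mdist_nonneg[of X x y] unfolding geodesic_segment_def by (metis atLeastAtMost_iff image_eqI order_refl)+
  then show ?thesis using \<iota> that by blast
qed

lemma chart_mem: "\<iota> \<in> charts \<Longrightarrow> \<iota> p \<in> mspace X"
  and chart_dist: "\<iota> \<in> charts \<Longrightarrow> mdist X (\<iota> p) (\<iota> q) = norm (q - p)"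
  using chart_isometric[of \<iota>] by (auto simp: isometric_on_def dist_norm norm_minus_commute)

lemma segment_coordinates:
  assumes x: "x \<in> mspace X" "y \<in> mspace X" and ne: "x \<noteq> y"
  obtains \<iota> p u where "\<iota> \<in> charts" "norm u = 1" "x = \<iota> p" "y = \<iota> (p + mdist X x y *\<^sub>R u)"
proof -
  obtain \<iota> p q where \<iota>: "\<iota> \<in> charts" "x = \<iota> p" "y = \<iota> q" using segment_in_chart[OF x] .
  have "q \<noteq> p" using \<iota> ne by auto
  moreover have "q = p + mdist X x y *\<^sub>R sgn (q - p)"
    using \<open>q \<noteq> p\<close> by (simp add: \<iota> chart_dist sgn_div_norm)
  ultimately show ?thesis using \<iota> by (intro that[of \<iota> "sgn (q - p)" p]) (auto simp: norm_sgn)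
qed

lemma chart_theta:
  assumes "\<iota> \<in> charts" "norm u = 1" "s < t"
  shows "\<theta> (\<iota> (p + s *\<^sub>R u)) (\<iota> (p + t *\<^sub>R u)) = direction_class W u"
    "\<theta> (\<iota> (p + t *\<^sub>R u)) (\<iota> (p + s *\<^sub>R u)) = direction_class W (- u)"
proof -
  have u: "u \<noteq> 0" using assms(2) by auto
  have "p + t *\<^sub>R u - (p + s *\<^sub>R u) = (t - s) *\<^sub>R u" "p + s *\<^sub>R u - (p + t *\<^sub>R u) = (t - s) *\<^sub>R - u"
    by (simp_all add: algebra_simps)
  moreover have "sgn ((t - s) *\<^sub>R u) = u" "sgn ((t - s) *\<^sub>R - u) = - u"
    using assms(2,3) by (simp_all add: sgn_div_norm)
  moreover have "p + s *\<^sub>R u \<noteq> p + t *\<^sub>R u" using u assms(3) by simp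
  ultimately show "\<theta> (\<iota> (p + s *\<^sub>R u)) (\<iota> (p + t *\<^sub>R u)) = direction_class W u"
    "\<theta> (\<iota> (p + t *\<^sub>R u)) (\<iota> (p + s *\<^sub>R u)) = direction_class W (- u)"
    using chart_direction[OF assms(1), of "p + s *\<^sub>R u" "p + t *\<^sub>R u"]
      chart_direction[OF assms(1), of "p + t *\<^sub>R u" "p + s *\<^sub>R u"] by auto
qed

lemma theta_class:
  assumes x: "x \<in> mspace X" "y \<in> mspace X" "x \<noteq> y" and a: "a \<in> \<theta> x y"
  shows "norm a = 1" "\<theta> x y = direction_class W a" "- a \<in> \<theta> y x"
proof -
  obtain \<iota> p u where \<iota>: "\<iota> \<in> charts" "norm u = 1" "x = \<iota> p" "y = \<iota> (p + mdist X x y *\<^sub>R u)"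
    using segment_coordinates[OF x] .
  have d: "0 < mdist X x y" using mdist_pos[OF x(1,2)] x(3) by simp
  have th: "\<theta> x y = direction_class W u" "\<theta> y x = direction_class W (- u)"
    using chart_theta[OF \<iota>(1,2) d, of p] \<iota>(3,4) by auto
  obtain w where w: "w \<in> W" "a = w u" using a th by (auto simp: direction_class_def)
  then show "norm a = 1" using W_norm \<iota>(2) by simp
  show "\<theta> x y = direction_class W a" using direction_class_eq a th by simp
  show "- a \<in> \<theta> y x" unfolding th direction_class_def using w W_neg by auto
qed

lemma theta_nonempty:
  assumes x: "x \<in> mspace X" "y \<in> mspace X" "x \<noteq> y"
  obtains a where "a \<in> \<theta> x y"
proof -
  obtain u where "\<theta> x y = direction_class W u"
    using direction_mem[OF x] by (auto simp: Delta_mod_def)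
  then show ?thesis using that direction_class_refl by blast
qed

text \<open>As \<open>W\<close> acts by isometries, one of the two directions may be represented by any
  given element of its orbit.\<close>

lemma Delta_distances_rep:
  assumes x: "p \<in> mspace X" "x \<in> mspace X" "x \<noteq> p" and y: "y \<in> mspace X" "y \<noteq> p"
    and d: "d \<in> Delta_distances (\<theta> p x) (\<theta> p y)" and b: "b \<in> \<theta> p y"
  obtains a where "a \<in> \<theta> p x" "d = arccos (a \<bullet> b)"
proof -
  obtain a v where av: "a \<in> \<theta> p x" "v \<in> \<theta> p y" "d = arccos (a \<bullet> v)"
    using d by (auto simp: Delta_distances_def direction_angle_def)
  obtain w where w: "w \<in> W" "b = w v"
    using theta_class(2)[OF x(1) y(1) _ av(2)] b y(2) by (auto simp: direction_class_def)
  have "w a \<in> \<theta> p x"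
    using theta_class(2)[OF x(1,2) _ av(1)] x(3) w(1) by (auto simp: direction_class_def)
  moreover have "d = arccos (w a \<bullet> b)" using av w by (simp add: W_inner)
  ultimately show ?thesis by (rule that)
qed

lemma abs_inner_unit_le_1: "norm (a::'e) = 1 \<Longrightarrow> norm b = 1 \<Longrightarrow> \<bar>a \<bullet> b\<bar> \<le> 1"
  using Cauchy_Schwarz_ineq2[of a b] by simp

text \<open>The map that sends \<open>x\<close> to the vector from \<open>p\<close> to \<open>x\<close> is
  \<open>1\<close>-Lipschitz. If \<open>a\<close> and \<open>b\<close> are nearest
  representatives, their angle is the distance of the directions in
  \<open>\<Delta>\<^sub>m\<^sub>o\<^sub>d\<close>, which is at most the comparison angle; so the
  claim is the law of cosines.\<close>

lemma log_contraction:
  assumes p: "p \<in> mspace X" and x: "x \<in> mspace X" "x \<noteq> p" and y: "y \<in> mspace X" "y \<noteq> p"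
    and a: "a \<in> \<theta> p x" and b: "b \<in> \<theta> p y"
    and close: "\<And>w. w \<in> W \<Longrightarrow> norm (a - b) \<le> norm (a - w b)"
  shows "norm (mdist X p x *\<^sub>R a - mdist X p y *\<^sub>R b) \<le> mdist X x y"
proof -
  have ab: "norm a = 1" "norm b = 1" using theta_class(1) p x y a b by metis+
  have le: "w a \<bullet> b \<le> a \<bullet> b" if w: "w \<in> W" for w
  proof -
    have "norm (a - b) \<le> norm (a - inv w b)" using close[OF W_inv[OF w]] .
    then have "(norm (a - b))\<^sup>2 \<le> (norm (a - inv w b))\<^sup>2" by (intro power_mono) auto
    moreover have "a \<bullet> inv w b = w a \<bullet> b" using W_inner[OF w, of a "inv w b"] W_inv_right[OF w] by simp
    moreover have "norm (inv w b) = 1" using W_norm[OF W_inv[OF w]] ab by simp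
    ultimately show ?thesis using ab by (simp add: power2_norm_eq_inner inner_diff inner_commute norm_eq_1)
  qed
  have "arccos (a \<bullet> b) \<le> Delta_dist (\<theta> p x) (\<theta> p y)"
    unfolding Delta_dist_def
  proof (rule cInf_greatest)
    show "Delta_distances (\<theta> p x) (\<theta> p y) \<noteq> {}" using a b by (auto simp: Delta_distances_def)
    fix d assume "d \<in> Delta_distances (\<theta> p x) (\<theta> p y)"
    then obtain a' where a': "a' \<in> \<theta> p x" "d = arccos (a' \<bullet> b)"
      using Delta_distances_rep[OF p x y _ b] by blast
    then obtain w where w: "w \<in> W" "a' = w a"
      using theta_class(2)[OF p x(1) _ a] x(2) by (auto simp: direction_class_def)
    have "norm a' = 1" using w ab W_norm by simp
    then show "arccos (a \<bullet> b) \<le> d"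
      using le[OF w(1)] w(2) a'(2) abs_inner_unit_le_1[of a' b] abs_inner_unit_le_1[of a b] ab
      by (simp add: arccos_le_mono)
  qed
  also have "\<dots> \<le> arccos (comparison_cos X p x y)"
    using direction_comparison[OF p x(1) y(1) x(2) y(2)] by (simp add: comparison_angle_eq)
  finally have "comparison_cos X p x y \<le> a \<bullet> b"
    using abs_comparison_cos_le_1[OF p x(1) y(1) x(2) y(2)] abs_inner_unit_le_1[OF ab]
    by (simp add: arccos_le_mono)
  then have "(mdist X p x)\<^sup>2 + (mdist X p y)\<^sup>2 - (mdist X x y)\<^sup>2 \<le> 2 * mdist X p x * mdist X p y * (a \<bullet> b)"
    using mdist_pos[OF p x] mdist_pos[OF p y] by (simp add: comparison_cos_def field_simps)
  moreover have "(norm (mdist X p x *\<^sub>R a - mdist X p y *\<^sub>R b))\<^sup>2 =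
      (mdist X p x)\<^sup>2 + (mdist X p y)\<^sup>2 - 2 * mdist X p x * mdist X p y * (a \<bullet> b)"
    unfolding power2_norm_eq_inner using ab
    by (simp add: inner_diff inner_commute norm_eq_1 power2_eq_square algebra_simps)
  ultimately have "(norm (mdist X p x *\<^sub>R a - mdist X p y *\<^sub>R b))\<^sup>2 \<le> (mdist X x y)\<^sup>2" by linarith
  then show ?thesis by (rule power2_le_imp_le) simp
qed

lemma comparison_cos_ge:
  assumes p: "p \<in> mspace X" and x: "x \<in> mspace X" "x \<noteq> p" and y: "y \<in> mspace X" "y \<noteq> p"
  shows "1 - (mdist X x y)\<^sup>2 / (2 * mdist X p x * mdist X p y) \<le> comparison_cos X p x y"
proof -
  have pos: "0 < mdist X p x" "0 < mdist X p y" using mdist_pos[OF p x] mdist_pos[OF p y] by auto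
  have "2 * mdist X p x * mdist X p y - (mdist X x y)\<^sup>2 \<le> (mdist X p x)\<^sup>2 + (mdist X p y)\<^sup>2 - (mdist X x y)\<^sup>2"
    using sum_squares_bound[of "mdist X p x" "mdist X p y"] by simp
  then show ?thesis using pos unfolding comparison_cos_def by (simp add: field_simps)
qed

text \<open>Points that are close relative to their distance from \<open>p\<close> span a small comparison
  angle at \<open>p\<close>, so their directions are close in
  \<open>\<Delta>\<^sub>m\<^sub>o\<^sub>d\<close>.\<close>

lemma close_direction:
  assumes p: "p \<in> mspace X" and x: "x \<in> mspace X" "x \<noteq> p" and y: "y \<in> mspace X" "y \<noteq> p"
    and b: "b \<in> \<theta> p y" and \<eta>: "0 < \<eta>" "\<eta> \<le> 1"
    and d: "mdist X x y \<le> \<eta> * mdist X p x" "mdist X x y \<le> \<eta> * mdist X p y"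
  obtains a where "a \<in> \<theta> p x" "norm (a - b) \<le> 2 * \<eta>"
proof -
  have pos: "0 < mdist X p x" "0 < mdist X p y" using mdist_pos[OF p x] mdist_pos[OF p y] by auto
  have "(mdist X x y)\<^sup>2 \<le> (\<eta> * mdist X p x) * (\<eta> * mdist X p y)"
    unfolding power2_eq_square using d \<eta> pos by (intro mult_mono) auto
  then have "(mdist X x y)\<^sup>2 / (2 * mdist X p x * mdist X p y) \<le> \<eta>\<^sup>2 / 2"
    using pos by (simp add: field_simps power2_eq_square)
  then have "1 - \<eta>\<^sup>2 / 2 \<le> comparison_cos X p x y" using comparison_cos_ge[OF p x y] by linarith
  moreover have \<eta>2: "0 < \<eta>\<^sup>2" "\<eta>\<^sup>2 \<le> 1" using \<eta> by (auto simp: power_le_one)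
  ultimately have lt: "1 - \<eta>\<^sup>2 < comparison_cos X p x y" by linarith
  have "Delta_dist (\<theta> p x) (\<theta> p y) \<le> arccos (comparison_cos X p x y)"
    using direction_comparison[OF p x(1) y(1) x(2) y(2)] by (simp add: comparison_angle_eq)
  also have "\<dots> < arccos (1 - \<eta>\<^sup>2)"
    using lt \<eta>2 abs_comparison_cos_le_1[OF p x(1) y(1) x(2) y(2)] by (intro arccos_less_arccos) auto
  finally have inf: "Inf (Delta_distances (\<theta> p x) (\<theta> p y)) < arccos (1 - \<eta>\<^sup>2)" by (simp add: Delta_dist_def)
  obtain a0 where "a0 \<in> \<theta> p x" using theta_nonempty p x by metis
  then have "Delta_distances (\<theta> p x) (\<theta> p y) \<noteq> {}" using b by (auto simp: Delta_distances_def)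
  then obtain d where d: "d \<in> Delta_distances (\<theta> p x) (\<theta> p y)" "d < arccos (1 - \<eta>\<^sup>2)"
    using inf cInf_lessD by blast
  obtain a where a: "a \<in> \<theta> p x" "d = arccos (a \<bullet> b)" using Delta_distances_rep[OF p x y d(1) b] .
  have ab: "norm a = 1" "norm b = 1" using theta_class(1) p x y a b by metis+
  have "1 - \<eta>\<^sup>2 < a \<bullet> b"
    using d(2) a(2) \<eta>2 abs_inner_unit_le_1[OF ab] by (simp add: arccos_less_mono)
  moreover have "(norm (a - b))\<^sup>2 = 2 - 2 * (a \<bullet> b)"
    using ab by (simp add: power2_norm_eq_inner inner_diff inner_commute norm_eq_1)
  moreover have "(2 * \<eta>)\<^sup>2 = 4 * \<eta>\<^sup>2" by (simp add: power_mult_distrib)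
  ultimately have "(norm (a - b))\<^sup>2 \<le> (2 * \<eta>)\<^sup>2" using \<eta>2 by linarith
  then have "norm (a - b) \<le> 2 * \<eta>" by (rule power2_le_imp_le) (use \<eta> in auto)
  then show ?thesis using that a(1) by blast
qed

lemma chart_straight_angle:
  fixes p :: 'e
  assumes \<iota>: "\<iota> \<in> charts" and u: "norm u = 1" and t: "0 < t" "t < T"
  defines "q \<equiv> \<iota> (p + t *\<^sub>R u)"
  obtains g k where "geodesic_segment X q (\<iota> p) g" "geodesic_segment X q (\<iota> (p + T *\<^sub>R u)) k"
    "cos (Alexandrov_angle X g k) \<le> - 1"
proof -
  define g k where "g s = \<iota> (p + (t - s) *\<^sub>R u)" and "k s = \<iota> (p + (t + s) *\<^sub>R u)" for s
  have d: "mdist X (\<iota> (p + s *\<^sub>R u)) (\<iota> (p + s' *\<^sub>R u)) = \<bar>s' - s\<bar>" for s s'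
    using u by (simp add: chart_dist[OF \<iota>] scaleR_diff_left[symmetric])
  have dq: "mdist X q (\<iota> p) = t" "mdist X q (\<iota> (p + T *\<^sub>R u)) = T - t"
    using d[of t 0] d[of t T] t by (auto simp: q_def)
  have g: "geodesic_segment X q (\<iota> p) g"
    unfolding geodesic_segment_def dq isometric_on_def
    using chart_mem[OF \<iota>] by (auto simp: g_def q_def d dist_real_def)
  have k: "geodesic_segment X q (\<iota> (p + T *\<^sub>R u)) k"
    unfolding geodesic_segment_def dq isometric_on_def
    using chart_mem[OF \<iota>] by (auto simp: k_def q_def d dist_real_def)
  have mem: "q \<in> mspace X" "\<iota> p \<in> mspace X" "\<iota> (p + T *\<^sub>R u) \<in> mspace X"
    using chart_mem[OF \<iota>] by (auto simp: q_def)
  have ne: "\<iota> p \<noteq> q" "\<iota> (p + T *\<^sub>R u) \<noteq> q" using dq t mem by auto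
  have "cos (Alexandrov_angle X g k) \<le> 1 - 2\<^sup>2 / 2"
  proof (rule cos_Alexandrov_le[OF CAT0 mem ne g k])
    show "2 * s \<le> mdist X (g s) (k s)" if "0 < s" for s
      unfolding g_def k_def d using that by simp
  qed (use t in auto)
  then show ?thesis using that[OF g k] by simp
qed

end

section \<open>Flat triangles in regular directions\<close>

text \<open>A building with a regular direction \<open>u\<^sub>0\<close>, and a radius
  \<open>\<rho>\<close> such that two vectors within \<open>\<rho>\<close> of
  \<open>u\<^sub>0\<close> realise the distance between their \<open>W\<close>-orbits. Both
  exist by \<open>exists_regular_direction\<close>.\<close>

locale regular_building = euclidean_building Waff X \<theta> charts
  for Waff :: "('e::euclidean_space \<Rightarrow> 'e) set" and X :: "'a metric"
    and \<theta> :: "'a \<Rightarrow> 'a \<Rightarrow> 'e set" and charts :: "('e \<Rightarrow> 'a) set" +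
  fixes u\<^sub>0 :: 'e and \<rho> :: real
  assumes u0: "norm u\<^sub>0 = 1" and \<rho>: "0 < \<rho>" "\<rho> \<le> 1"
    and regular: "\<lbrakk>w \<in> linear_parts Waff; norm (v - u\<^sub>0) \<le> \<rho>; norm (v' - u\<^sub>0) \<le> \<rho>\<rbrakk>
      \<Longrightarrow> norm (v - v') \<le> norm (v - w v')"
begin

lemma regular_representative_unique:
  assumes x: "x \<in> mspace X" "y \<in> mspace X" "x \<noteq> y" and a: "a \<in> \<theta> x y" "b \<in> \<theta> x y"
    and near: "norm (a - u\<^sub>0) \<le> \<rho>" "norm (b - u\<^sub>0) \<le> \<rho>"
  shows "a = b"
proof -
  obtain w where "w \<in> W" "b = w a"
    using theta_class(2)[OF x a(1)] a(2) by (auto simp: direction_class_def)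
  then show ?thesis using regular[OF _ near(2,1), of w] by simp
qed

lemma log_contraction_regular:
  assumes p: "p \<in> mspace X" and x: "x \<in> mspace X" "x \<noteq> p" and y: "y \<in> mspace X" "y \<noteq> p"
    and near: "norm (a - u\<^sub>0) \<le> \<rho>" "norm (b - u\<^sub>0) \<le> \<rho>"
  shows "a \<in> \<theta> p x \<Longrightarrow> b \<in> \<theta> p y \<Longrightarrow> norm (mdist X p x *\<^sub>R a - mdist X p y *\<^sub>R b) \<le> mdist X x y"
    "a \<in> \<theta> x p \<Longrightarrow> b \<in> \<theta> y p \<Longrightarrow> norm (mdist X p x *\<^sub>R a - mdist X p y *\<^sub>R b) \<le> mdist X x y"
proof -
  show "norm (mdist X p x *\<^sub>R a - mdist X p y *\<^sub>R b) \<le> mdist X x y" if "a \<in> \<theta> p x" "b \<in> \<theta> p y"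
    using log_contraction[OF p x y that] regular[OF _ near] by blast
  assume ab: "a \<in> \<theta> x p" "b \<in> \<theta> y p"
  have "- a \<in> \<theta> p x" "- b \<in> \<theta> p y" using theta_class(3) p x y ab by metis+
  moreover have "norm (- a - (- b)) \<le> norm (- a - w (- b))" if "w \<in> W" for w
    using regular[OF that near] W_neg[OF that] by (simp add: norm_minus_commute)
  ultimately have "norm (mdist X p x *\<^sub>R (- a) - mdist X p y *\<^sub>R (- b)) \<le> mdist X x y"
    using log_contraction[OF p x y] by blast
  then show "norm (mdist X p x *\<^sub>R a - mdist X p y *\<^sub>R b) \<le> mdist X x y"
    by (simp add: norm_minus_commute)
qed

text \<open>The comparison axiom at \<open>y\<close> and \<open>p\<close> and the CAT(0) inequality at
  \<open>q\<close> compare the angle between two directions with a comparison angle. In the form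
  of the law of cosines these are bounds for the norms of three pairwise combinations of the
  vectors \<open>|yq| c\<close>, \<open>|qp| a\<close> and \<open>|yp| b\<close>. The three
  bounds add up to the statement that the norm of \<open>|yq| c + |qp| a - |yp| b\<close>
  squared is at most \<open>0\<close>.\<close>

lemma flat_triangle:
  assumes mem: "y \<in> mspace X" "q \<in> mspace X" "p \<in> mspace X" and ne: "y \<noteq> q" "p \<noteq> q" "y \<noteq> p"
    and h: "geodesic_segment X q y h" and k: "geodesic_segment X q p k"
    and a: "a \<in> \<theta> q p" "norm (a - u\<^sub>0) \<le> \<rho>" and b: "b \<in> \<theta> y p" "norm (b - u\<^sub>0) \<le> \<rho>"
    and c: "c \<in> \<theta> y q" "norm (c - u\<^sub>0) \<le> \<rho>"
    and angle: "cos (Alexandrov_angle X h k) = - (c \<bullet> a)"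
  shows "mdist X y q *\<^sub>R c + mdist X q p *\<^sub>R a = mdist X y p *\<^sub>R b"
proof -
  define A B D where "A = mdist X y q" and "B = mdist X q p" and "D = mdist X y p"
  have pos: "0 < A" "0 < B" "0 < D"
    using mdist_pos[of y X q] mdist_pos[of q X p] mdist_pos[of y X p] mem ne by (auto simp: A_def B_def D_def)
  have n: "norm a = 1" "norm b = 1" "norm c = 1" using theta_class(1) mem ne a b c by metis+
  have "norm (A *\<^sub>R c - D *\<^sub>R b) \<le> B"
    using log_contraction_regular(1)[OF mem(1,2) _ mem(3) _ c(2) b(2)] c b ne by (simp add: A_def B_def D_def)
  then have 1: "(norm (A *\<^sub>R c - D *\<^sub>R b))\<^sup>2 \<le> B\<^sup>2" by (intro power_mono) auto
  have "norm (D *\<^sub>R b - B *\<^sub>R a) \<le> A"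
    using log_contraction_regular(2)[OF mem(3,1) _ mem(2) _ b(2) a(2)] a b ne
    by (auto simp: A_def B_def D_def mdist_commute)
  then have 2: "(norm (D *\<^sub>R b - B *\<^sub>R a))\<^sup>2 \<le> A\<^sup>2" by (intro power_mono) auto
  have "comparison_cos X q y p \<le> - (c \<bullet> a)"
    using Alexandrov_angle_bounds(4)[OF CAT0 mem(2,1,3) ne(1,2) h k] angle by simp
  then have 3: "A\<^sup>2 + B\<^sup>2 + 2 * A * B * (c \<bullet> a) \<le> D\<^sup>2"
    using pos unfolding comparison_cos_def
    by (simp add: mdist_commute[of X q y] A_def[symmetric] B_def[symmetric] D_def[symmetric] field_simps)
  have "(norm (A *\<^sub>R c + B *\<^sub>R a - D *\<^sub>R b))\<^sup>2 =
      (norm (A *\<^sub>R c - D *\<^sub>R b))\<^sup>2 + (norm (D *\<^sub>R b - B *\<^sub>R a))\<^sup>2 + 2 * A * B * (c \<bullet> a) - D\<^sup>2"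
    unfolding power2_norm_eq_inner using n
    by (simp add: inner_diff inner_add inner_commute norm_eq_1 power2_eq_square algebra_simps)
  also have "\<dots> \<le> 0" using 1 2 3 by linarith
  finally show ?thesis by (simp add: A_def B_def D_def)
qed

text \<open>The step along a chain. Suppose that \<open>x\<close> and \<open>p\<close> are seen from
  \<open>q\<close> in nearly opposite directions, namely under the angle between \<open>-
  c0\<close> and \<open>a\<close>, and that \<open>y\<close> is close to \<open>x\<close>
  relative to their distance from \<open>q\<close>. Comparing chords shows that \<open>y\<close>
  and \<open>p\<close> are seen in nearly opposite directions, too. The angle at
  \<open>q\<close> between them is then the angle between \<open>- c\<close> and
  \<open>a\<close> for a representative \<open>c\<close> of the direction from \<open>y\<close>
  to \<open>q\<close>, which must be close to \<open>u\<^sub>0\<close>. So the triangle is flat,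
  and the deviation from a straight angle is now governed by \<open>c\<close> alone.\<close>

lemma straight_angle_transfer:
  assumes mem: "x \<in> mspace X" "y \<in> mspace X" "q \<in> mspace X" "p \<in> mspace X"
    and ne: "x \<noteq> q" "y \<noteq> q" "p \<noteq> q" "y \<noteq> p"
    and g: "geodesic_segment X q x g" and k: "geodesic_segment X q p k"
    and a: "a \<in> \<theta> q p" "norm (a - u\<^sub>0) \<le> \<rho> / 2" and b: "b \<in> \<theta> y p" "norm (b - u\<^sub>0) \<le> \<rho>"
    and c0: "norm c0 = 1" "cos (Alexandrov_angle X g k) \<le> - (c0 \<bullet> a)"
    and small: "norm (c0 - a) + 2 * mdist X x y / mdist X q x \<le> \<rho>\<^sup>2 / 16"
  obtains h c where "geodesic_segment X q y h" "c \<in> \<theta> y q" "norm (c - u\<^sub>0) \<le> \<rho>"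
    "cos (Alexandrov_angle X h k) \<le> - (c \<bullet> a)"
    "mdist X y q *\<^sub>R c + mdist X q p *\<^sub>R a = mdist X y p *\<^sub>R b"
proof -
  obtain h where h: "geodesic_segment X q y h" using CAT0 mem unfolding CAT0_def by blast
  define A B D where "A = mdist X q x" and "B = mdist X q y" and "D = mdist X x y"
  have pos: "0 < A" "0 < B" "0 \<le> D" using mdist_pos mem ne by (auto simp: A_def B_def D_def)
  define \<eta> where "\<eta> = norm (c0 - a) + 2 * D / A"
  have "\<rho>\<^sup>2 \<le> 1" using \<rho> by (simp add: power_le_one)
  then have \<eta>: "0 \<le> \<eta>" "\<eta> \<le> \<rho>\<^sup>2 / 16" "\<eta> \<le> 1 / 16" using small pos by (auto simp: \<eta>_def A_def D_def)
  have na: "norm a = 1" using theta_class(1) mem ne a by metis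
  have "2 * D / A \<le> \<eta>" by (simp add: \<eta>_def)
  then have "2 * D / A \<le> 1 / 16" using \<eta> by linarith
  then have DA: "2 * D \<le> A / 16" using pos by (simp add: field_simps)
  have "A \<le> B + D" using mdist_triangle[of q X y x] mem by (simp add: A_def B_def D_def mdist_commute)
  then have AB: "A \<le> 2 * B" using DA pos by linarith
  \<comment> \<open>The chord from \<open>g s\<close> to \<open>k s\<close> is almost \<open>2 s\<close>, the one from \<open>g s\<close> to \<open>h s\<close> is short.\<close>
  have chord: "(2 - \<eta>) * s \<le> mdist X (h s) (k s)" if s: "0 < s" "s < min (min A B) (mdist X q p)" for s
  proof -
    have gs: "g s \<in> mspace X" and hs: "h s \<in> mspace X" and ks: "k s \<in> mspace X"
      using geodesic_segment_dist(1)[OF g] geodesic_segment_dist(1)[OF h] geodesic_segment_dist(1)[OF k] s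
      by (auto simp: A_def B_def)
    have "s\<^sup>2 * (norm (c0 + a))\<^sup>2 \<le> s\<^sup>2 * (2 - 2 * cos (Alexandrov_angle X g k))"
    proof (rule mult_left_mono)
      show "(norm (c0 + a))\<^sup>2 \<le> 2 - 2 * cos (Alexandrov_angle X g k)"
        using c0 na by (simp add: power2_norm_eq_inner inner_add inner_commute norm_eq_1)
    qed simp
    also have "\<dots> \<le> (mdist X (g s) (k s))\<^sup>2"
      using s by (intro chord_ge_Alexandrov[OF CAT0 mem(3,1,4) ne(1,3) g k]) (auto simp: A_def)
    finally have "(s * norm (c0 + a))\<^sup>2 \<le> (mdist X (g s) (k s))\<^sup>2" by (simp add: power_mult_distrib)
    then have 1: "s * norm (c0 + a) \<le> mdist X (g s) (k s)" by (rule power2_le_imp_le) simp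
    have "norm (2 *\<^sub>R a) \<le> norm (c0 + a) + norm (c0 - a)"
      using norm_triangle_ineq4[of "c0 + a" "c0 - a"] by (simp add: scaleR_2)
    then have "s * (2 - norm (c0 - a)) \<le> s * norm (c0 + a)"
      using na s by (intro mult_left_mono) auto
    then have 2: "s * (2 - norm (c0 - a)) \<le> mdist X (g s) (k s)" using 1 by linarith
    have "(mdist X (g s) (h s))\<^sup>2 \<le> s\<^sup>2 + s\<^sup>2 - 2 * s * s * comparison_cos X q x y"
      using s by (intro CAT0_law_of_cosines[OF CAT0 mem(3,1,2) ne(1,2) g h]) (auto simp: A_def B_def)
    also have "\<dots> = 2 * s\<^sup>2 * (1 - comparison_cos X q x y)" by (simp add: power2_eq_square algebra_simps)
    also have "\<dots> \<le> 2 * s\<^sup>2 * (D\<^sup>2 / A\<^sup>2)"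
    proof (rule mult_left_mono)
      have "D\<^sup>2 / (2 * A * B) \<le> D\<^sup>2 / A\<^sup>2"
        using pos AB by (intro divide_left_mono) (auto simp: power2_eq_square)
      then show "1 - comparison_cos X q x y \<le> D\<^sup>2 / A\<^sup>2"
        using comparison_cos_ge[OF mem(3,1) ne(1) mem(2) ne(2)] by (simp add: A_def B_def D_def)
    qed simp
    also have "\<dots> \<le> 4 * s\<^sup>2 * (D\<^sup>2 / A\<^sup>2)" by (intro mult_right_mono) auto
    also have "\<dots> = (s * (2 * D / A))\<^sup>2"
      by (simp add: power_mult_distrib power_divide)
    finally have 3: "mdist X (g s) (h s) \<le> s * (2 * D / A)"
      by (rule power2_le_imp_le) (use s pos in auto)
    have "mdist X (g s) (k s) \<le> mdist X (g s) (h s) + mdist X (h s) (k s)"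
      using gs hs ks by (rule mdist_triangle)
    then show ?thesis using 2 3 by (simp add: \<eta>_def algebra_simps)
  qed
  have "cos (Alexandrov_angle X h k) \<le> 1 - (2 - \<eta>)\<^sup>2 / 2"
  proof (rule cos_Alexandrov_le[OF CAT0 mem(3,2,4) ne(2,3) h k _ _ _ chord])
    show "0 < min (min A B) (mdist X q p)" using pos mdist_pos[OF mem(3,4) ne(3)] by simp
  qed (use \<eta> in auto)
  also have "\<dots> = - 1 + 2 * \<eta> - \<eta>\<^sup>2 / 2" by (simp add: power2_diff field_simps)
  also have "\<dots> \<le> - 1 + 2 * \<eta>" by simp
  finally have cosle: "cos (Alexandrov_angle X h k) \<le> - 1 + 2 * \<eta>" .
  obtain v where v: "v \<in> \<theta> q y" "Alexandrov_angle X h k = arccos (v \<bullet> a)"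
    using Delta_distances_rep[OF mem(3,2) ne(2) mem(4) ne(3)
        angle_rigidity[OF mem(3,2,4) ne(2,3) h k] a(1)] .
  \<comment> \<open>Reversing a segment negates its direction, so the angle at \<open>q\<close> is \<open>\<pi>\<close> minus the angle between \<open>c\<close> and \<open>a\<close>.\<close>
  define c where "c = - v"
  have c: "c \<in> \<theta> y q" unfolding c_def using theta_class(3) mem ne v by metis
  have nc: "norm c = 1" using theta_class(1) mem ne c by metis
  have cos: "cos (Alexandrov_angle X h k) = - (c \<bullet> a)"
    using v(2) abs_inner_unit_le_1[OF nc na] by (simp add: c_def abs_le_iff)
  have "(norm (c - a))\<^sup>2 = 2 - 2 * (c \<bullet> a)"
    using nc na by (simp add: power2_norm_eq_inner inner_diff inner_commute norm_eq_1)
  also have "\<dots> \<le> (\<rho> / 2)\<^sup>2" using cosle cos \<eta> by (simp add: power_divide)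
  finally have "norm (c - a) \<le> \<rho> / 2" by (rule power2_le_imp_le) (use \<rho> in auto)
  then have cu: "norm (c - u\<^sub>0) \<le> \<rho>" using a(2) norm_triangle_ineq[of "c - a" "a - u\<^sub>0"] by simp
  have "mdist X y q *\<^sub>R c + mdist X q p *\<^sub>R a = mdist X y p *\<^sub>R b"
    using a \<rho> by (intro flat_triangle[OF mem(2,3,4) ne(2,3,4) h k a(1) _ b c cu cos]) auto
  then show ?thesis using that[OF h c cu] cos by simp
qed

end

section \<open>Retraction to an apartment from infinity\<close>

context regular_building
begin

text \<open>Seen from the point with parameter \<open>t\<close> on the ray, the origin of the ray and a
  point of the ray further out are opposite, and so \<open>x\<close> is nearly opposite to the
  latter if \<open>t\<close> is large compared to the distance of \<open>x\<close> from the
  origin. By the flatness of the triangle, the vector from \<open>x\<close> to the ray grows by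
  exactly \<open>(T - t) u\<^sub>0\<close> from \<open>t\<close> to \<open>T\<close>.\<close>

lemma horospherical_limit:
  assumes \<iota>: "\<iota> \<in> charts" and x: "x \<in> mspace X"
  shows "\<exists>F T\<^sub>0. \<forall>T\<ge>T\<^sub>0. x \<noteq> \<iota> (T *\<^sub>R u\<^sub>0) \<and>
    (\<exists>b \<in> \<theta> x (\<iota> (T *\<^sub>R u\<^sub>0)). norm (b - u\<^sub>0) \<le> \<rho> / 2 \<and>
       F = T *\<^sub>R u\<^sub>0 - mdist X x (\<iota> (T *\<^sub>R u\<^sub>0)) *\<^sub>R b)"
proof -
  define p where "p T = \<iota> (T *\<^sub>R u\<^sub>0)" for T
  define D where "D = mdist X x (\<iota> 0)"
  \<comment> \<open>For the straight angle to transfer from \<open>\<iota> 0\<close> to \<open>x\<close> at parameter \<open>t\<close>, the quotient \<open>2 D / t\<close> must be at most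
    \<open>\<rho>\<^sup>2 / 16\<close>; the excess makes \<open>t\<close> positive and leaves room for the existence of \<open>b\<close>.\<close>
  define t where "t = 64 * (D + 1) / \<rho>\<^sup>2"
  have p0: "p 0 = \<iota> 0" by (simp add: p_def)
  have D0: "0 \<le> D" by (simp add: D_def)
  have pX: "p T \<in> mspace X" for T using chart_mem[OF \<iota>] by (simp add: p_def)
  have dp: "mdist X (p s) (p T) = \<bar>T - s\<bar>" for s T
    using u0 by (simp add: p_def chart_dist[OF \<iota>] scaleR_diff_left[symmetric])
  have th: "u\<^sub>0 \<in> \<theta> (p s) (p T)" if "s < T" for s T
    using chart_theta(1)[OF \<iota> u0 that, of 0] direction_class_refl by (simp add: p_def)
  have "\<rho>\<^sup>2 \<le> \<rho>" using \<rho> by (simp add: power2_eq_square mult_left_le)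
  then have r: "0 < \<rho>\<^sup>2" "\<rho>\<^sup>2 \<le> \<rho>" using \<rho> by auto
  have t\<rho>: "\<rho>\<^sup>2 * t = 64 * (D + 1)" using r by (simp add: t_def)
  have t0: "0 < t" using D0 r by (simp add: t_def)
  have "\<rho>\<^sup>2 * t \<le> \<rho> * t" "\<rho> * t \<le> t" using r \<rho> t0 by (auto intro!: mult_right_mono simp: mult_le_cancel_right1)
  then have tD: "64 * (D + 1) \<le> \<rho> * t" "64 * (D + 1) \<le> t" using t\<rho> by linarith+
  have far: "64 * (D + 1) \<le> \<rho> * T" "T - D \<le> mdist X (p T) x" "D < mdist X (p T) x" "0 < T" if T: "t \<le> T" for T
  proof -
    show "64 * (D + 1) \<le> \<rho> * T" using tD(1) mult_left_mono[OF T, of \<rho>] \<rho> by linarith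
    show *: "T - D \<le> mdist X (p T) x"
      using mdist_triangle[OF pX[of T] x pX[of 0]] dp[of T 0] t0 T by (simp add: D_def p0)
    show "D < mdist X (p T) x" using * D0 order_trans[OF tD(2) T] by argo
    show "0 < T" using t0 T by linarith
  qed
  have ne: "x \<noteq> p T" if "t \<le> T" for T using far(3)[OF that] D0 x by auto
  have ex: "\<exists>b \<in> \<theta> x (p T). norm (b - u\<^sub>0) \<le> \<rho> / 2" if T: "t \<le> T" for T
  proof -
    have ne0: "p 0 \<noteq> p T" using dp[of 0 T] far(4)[OF T] pX[of T] by auto
    have "- u\<^sub>0 \<in> \<theta> (p T) (p 0)"
      using theta_class(3)[OF pX pX ne0 th[OF far(4)[OF T]]] .
    moreover have "mdist X x (p 0) \<le> \<rho> / 4 * mdist X (p T) x"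
    proof -
      have "\<rho> * (T - D) \<le> \<rho> * mdist X (p T) x" using far(2)[OF T] \<rho> by (intro mult_left_mono) auto
      moreover have "\<rho> * D \<le> D" using \<rho> D0 by (simp add: mult_left_le_one_le)
      ultimately show ?thesis using far(1)[OF T] D0 by (simp add: D_def[symmetric] p0 algebra_simps)
    qed
    moreover have "mdist X x (p 0) \<le> \<rho> / 4 * mdist X (p T) (p 0)"
      using far(1)[OF T] far(4)[OF T] D0 unfolding dp by (simp add: D_def[symmetric] p0)
    ultimately obtain a where a: "a \<in> \<theta> (p T) x" "norm (a - (- u\<^sub>0)) \<le> 2 * (\<rho> / 4)"
      using close_direction[OF pX x ne[OF T] pX ne0, of "- u\<^sub>0" "\<rho> / 4"] \<rho> by auto
    have "- a \<in> \<theta> x (p T)" using theta_class(3)[OF pX x _ a(1)] ne[OF T] by metis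
    moreover have "norm (- a - u\<^sub>0) \<le> \<rho> / 2"
      using a(2) norm_minus_cancel[of "a + u\<^sub>0"] by simp
    ultimately show ?thesis by blast
  qed
  obtain b where b: "b \<in> \<theta> x (p t)" "norm (b - u\<^sub>0) \<le> \<rho> / 2" using ex by blast
  have "T *\<^sub>R u\<^sub>0 - mdist X x (p T) *\<^sub>R b' = t *\<^sub>R u\<^sub>0 - mdist X x (p t) *\<^sub>R b"
    if T: "t \<le> T" and b': "b' \<in> \<theta> x (p T)" "norm (b' - u\<^sub>0) \<le> \<rho> / 2" for T b'
  proof (cases "T = t")
    case True
    then have "b' = b" using regular_representative_unique[OF x pX ne[OF T]] b b' \<rho> by auto
    then show ?thesis using True by simp
  next
    case False
    then have lt: "t < T" using T by simp
    obtain g k where g: "geodesic_segment X (p t) (p 0) g" and k: "geodesic_segment X (p t) (p T) k"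
      and c: "cos (Alexandrov_angle X g k) \<le> - 1"
      using chart_straight_angle[OF \<iota> u0 t0 lt, of 0] by (auto simp: p_def)
    have nes: "p 0 \<noteq> p t" "p T \<noteq> p t"
      using dp[of 0 t] dp[of T t] t0 lt pX[of t] by auto
    have "norm (u\<^sub>0 - u\<^sub>0) + 2 * mdist X (p 0) x / mdist X (p t) (p 0) \<le> \<rho>\<^sup>2 / 16"
      using t\<rho> t0 D0 unfolding dp mdist_commute[of X "p 0" x]
      by (simp add: p0 D_def[symmetric] field_simps)
    then obtain c where c: "c \<in> \<theta> x (p t)" "norm (c - u\<^sub>0) \<le> \<rho>"
      "mdist X x (p t) *\<^sub>R c + mdist X (p t) (p T) *\<^sub>R u\<^sub>0 = mdist X x (p T) *\<^sub>R b'"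
      using straight_angle_transfer[OF pX x pX pX nes(1) ne nes(2) ne g k th[OF lt] _ b'(1) _ u0] lt T c b'(2) u0 \<rho>
      by (auto simp: power2_norm_eq_inner[symmetric] dot_square_norm)
    have "c = b" using regular_representative_unique[OF x pX ne[OF order_refl] c(1) b(1) c(2)] b(2) \<rho> by simp
    then show ?thesis using c(3)[symmetric] lt by (simp add: dp algebra_simps)
  qed
  then show ?thesis
    using ex ne unfolding p_def
    by (intro exI[of _ "t *\<^sub>R u\<^sub>0 - mdist X x (\<iota> (t *\<^sub>R u\<^sub>0)) *\<^sub>R b"] exI[of _ t]) metis
qed

text \<open>The invariant of the induction along the chain: the vector from \<open>z i\<close> to
  \<open>q\<close> equals \<open>t a + F (z 0) - F (z i)\<close>, and the angle at
  \<open>q\<close> is at least the angle that this vector predicts. Since \<open>F\<close>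
  varies by at most \<open>r\<close>, the vector stays within \<open>r\<close> of \<open>t
  a\<close>, so the smallness condition of the transfer step, \<open>6 / M = \<rho>\<^sup>2 /
  16\<close>, is available at every step.\<close>

lemma horospherical_map:
  assumes \<iota>: "\<iota> \<in> charts"
  obtains F :: "'a \<Rightarrow> 'e" and M where "1 \<le> M"
    "\<And>x y. \<lbrakk>x \<in> mspace X; y \<in> mspace X\<rbrakk> \<Longrightarrow> norm (F x - F y) \<le> mdist X x y"
    "\<And>r z k. \<lbrakk>0 < r; \<And>i. i \<le> k \<Longrightarrow> z i \<in> mspace X; \<And>i. i < k \<Longrightarrow> mdist X (z i) (z (Suc i)) \<le> r;
       \<And>i j. i \<le> k \<Longrightarrow> j \<le> k \<Longrightarrow> norm (F (z i) - F (z j)) \<le> r\<rbrakk> \<Longrightarrow> mdist X (z 0) (z k) \<le> M * r"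
proof -
  define p where "p T = \<iota> (T *\<^sub>R u\<^sub>0)" for T
  have pX: "p T \<in> mspace X" for T using chart_mem[OF \<iota>] by (simp add: p_def)
  obtain F T\<^sub>0 where F: "\<And>x T. x \<in> mspace X \<Longrightarrow> T\<^sub>0 x \<le> T \<Longrightarrow> x \<noteq> p T \<and>
    (\<exists>b \<in> \<theta> x (p T). norm (b - u\<^sub>0) \<le> \<rho> / 2 \<and> F x = T *\<^sub>R u\<^sub>0 - mdist X x (p T) *\<^sub>R b)"
    using horospherical_limit[OF \<iota>] unfolding p_def by metis
  \<comment> \<open>The transfer step will need \<open>2 / M + 4 / M \<le> \<rho>\<^sup>2 / 16\<close>.\<close>
  define M where "M = 96 / \<rho>\<^sup>2"
  have \<rho>2: "0 < \<rho>\<^sup>2" "\<rho>\<^sup>2 \<le> 1" using \<rho> by (auto simp: power_le_one)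
  have M: "96 \<le> M" "6 / M = \<rho>\<^sup>2 / 16" using \<rho>2 by (simp_all add: M_def field_simps)
  show ?thesis
  proof (rule that[of "2 * M + 1" F])
    show "1 \<le> 2 * M + 1" using M by simp
    fix x y assume x: "x \<in> mspace X" and y: "y \<in> mspace X"
    define T where "T = max (T\<^sub>0 x) (T\<^sub>0 y)"
    obtain b c where b: "x \<noteq> p T" "b \<in> \<theta> x (p T)" "norm (b - u\<^sub>0) \<le> \<rho> / 2" "F x = T *\<^sub>R u\<^sub>0 - mdist X x (p T) *\<^sub>R b"
      and c: "y \<noteq> p T" "c \<in> \<theta> y (p T)" "norm (c - u\<^sub>0) \<le> \<rho> / 2" "F y = T *\<^sub>R u\<^sub>0 - mdist X y (p T) *\<^sub>R c"
      using F[OF x, of T] F[OF y, of T] by (auto simp: T_def)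
    have "norm (mdist X (p T) x *\<^sub>R b - mdist X (p T) y *\<^sub>R c) \<le> mdist X x y"
      using b c \<rho> by (intro log_contraction_regular(2)[OF pX x b(1) y c(1)]) auto
    then show "norm (F x - F y) \<le> mdist X x y"
      unfolding b(4) c(4) by (simp add: mdist_commute norm_minus_commute)
  next
    fix r :: real and z :: "nat \<Rightarrow> 'a" and k
    assume r: "0 < r" and z: "\<And>i. i \<le> k \<Longrightarrow> z i \<in> mspace X"
      and step: "\<And>i. i < k \<Longrightarrow> mdist X (z i) (z (Suc i)) \<le> r"
      and FF: "\<And>i j. i \<le> k \<Longrightarrow> j \<le> k \<Longrightarrow> norm (F (z i) - F (z j)) \<le> r"
    define t where "t = M * r"
    \<comment> \<open>One \<open>T\<close> serves the whole finite chain, and \<open>P\<close> is further than \<open>t\<close> from \<open>z 0\<close>.\<close>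
    define T where "T = Max (insert (t + mdist X (z 0) (p 0) + 1) ((\<lambda>i. T\<^sub>0 (z i)) ` {..k}))"
    have T: "t + mdist X (z 0) (p 0) + 1 \<le> T" "\<And>i. i \<le> k \<Longrightarrow> T\<^sub>0 (z i) \<le> T"
      unfolding T_def by (auto intro!: Max_ge simp del: Max_insert)
    have t: "96 * r \<le> t" using M r by (simp add: t_def)
    have t0: "0 < t" using t r by linarith
    have z0: "z 0 \<in> mspace X" using z by simp
    define P where "P = p T"
    have P: "P \<in> mspace X" using pX by (simp add: P_def)
    have FP: "z i \<noteq> P \<and> (\<exists>b \<in> \<theta> (z i) P. norm (b - u\<^sub>0) \<le> \<rho> / 2 \<and> F (z i) = T *\<^sub>R u\<^sub>0 - mdist X (z i) P *\<^sub>R b)"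
      if "i \<le> k" for i using F[OF z T(2)] that by (simp add: P_def)
    define L where "L = mdist X (z 0) P"
    have "mdist X (p 0) P = T"
    proof -
      have "0 \<le> T" using T(1) t0 mdist_nonneg[of X "z 0" "p 0"] by linarith
      then show ?thesis using u0 by (simp add: P_def p_def chart_dist[OF \<iota>])
    qed
    then have L: "t < L"
      using mdist_triangle[OF pX z0 P, of 0] T(1) mdist_commute[of X "p 0" "z 0"] by (simp add: L_def)
    obtain a where a: "a \<in> \<theta> (z 0) P" "norm (a - u\<^sub>0) \<le> \<rho> / 2" "F (z 0) = T *\<^sub>R u\<^sub>0 - L *\<^sub>R a"
      using FP[of 0] by (auto simp: L_def)
    have na: "norm a = 1" using theta_class(1)[OF z0 P _ a(1)] FP[of 0] by simp
    have z0P: "z 0 \<noteq> P" using FP[of 0] by simp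
    obtain \<iota>' e u where \<iota>': "\<iota>' \<in> charts" "norm u = 1" "z 0 = \<iota>' e" "P = \<iota>' (e + L *\<^sub>R u)"
      by (rule segment_coordinates[OF z0 P z0P, folded L_def])
    define q where "q = \<iota>' (e + t *\<^sub>R u)"
    have q: "q \<in> mspace X" using chart_mem[OF \<iota>'(1)] by (simp add: q_def)
    have d: "mdist X q (z 0) = t" "mdist X q P = L - t"
      using \<iota>' t0 L by (simp_all add: q_def chart_dist[OF \<iota>'(1)] scaleR_diff_left[symmetric])
    have th: "\<theta> q P = \<theta> (z 0) P"
      using chart_theta(1)[OF \<iota>'(1,2) L, of e] chart_theta(1)[OF \<iota>'(1,2), of 0 L e] t0 L
      by (simp add: q_def \<iota>'(3,4))
    have Pq: "P \<noteq> q" using d(2) L q by auto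
    obtain g\<^sub>0 h where g0: "geodesic_segment X q (z 0) g\<^sub>0" and h: "geodesic_segment X q P h"
      and straight: "cos (Alexandrov_angle X g\<^sub>0 h) \<le> - 1"
      using chart_straight_angle[OF \<iota>'(1,2) t0 L, of e] unfolding q_def \<iota>'(3,4) by blast
    have "\<exists>g c. geodesic_segment X q (z i) g \<and> norm c = 1 \<and> cos (Alexandrov_angle X g h) \<le> - (c \<bullet> a) \<and>
        mdist X q (z i) *\<^sub>R c = t *\<^sub>R a + F (z 0) - F (z i)" if "i \<le> k" for i
      using that
    proof (induction i)
      case 0
      then show ?case using g0 straight na d by (intro exI[of _ g\<^sub>0] exI[of _ a]) (simp add: norm_eq_1)
    next
      case (Suc i)
      then obtain g c where g: "geodesic_segment X q (z i) g" and c: "norm c = 1"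
        "cos (Alexandrov_angle X g h) \<le> - (c \<bullet> a)" "mdist X q (z i) *\<^sub>R c = t *\<^sub>R a + F (z 0) - F (z i)"
        by auto
      define A where "A = mdist X q (z i)"
      have i: "z i \<in> mspace X" "z (Suc i) \<in> mspace X" "mdist X (z i) (z (Suc i)) \<le> r"
        using z step Suc.prems by auto
      have "A *\<^sub>R c - t *\<^sub>R a = F (z 0) - F (z i)" using c(3) by (simp add: A_def)
      then have Aca: "norm (A *\<^sub>R c - t *\<^sub>R a) \<le> r" using FF[of 0 i] Suc.prems by simp
      have At: "\<bar>A - t\<bar> \<le> r"
        using norm_triangle_ineq3[of "A *\<^sub>R c" "t *\<^sub>R a"] Aca c(1) na t0 by (simp add: A_def)
      have "norm (t *\<^sub>R (c - a)) \<le> norm (t *\<^sub>R c - A *\<^sub>R c) + norm (A *\<^sub>R c - t *\<^sub>R a)"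
        using norm_triangle_ineq[of "t *\<^sub>R c - A *\<^sub>R c" "A *\<^sub>R c - t *\<^sub>R a"] by (simp add: scaleR_diff_right)
      also have "norm (t *\<^sub>R c - A *\<^sub>R c) = \<bar>A - t\<bar>"
        using c(1) by (simp add: scaleR_diff_left[symmetric] abs_minus_commute)
      finally have "t * norm (c - a) \<le> 2 * r" using At Aca t0 by simp
      then have "norm (c - a) \<le> 2 / M" using r M t0 by (simp add: t_def field_simps)
      moreover have "2 * mdist X (z i) (z (Suc i)) / A \<le> 4 / M"
      proof -
        have "M * (2 * mdist X (z i) (z (Suc i))) \<le> M * (2 * r)" using i(3) M by (intro mult_left_mono) auto
        also have "\<dots> = 2 * t" by (simp add: t_def)
        also have "\<dots> \<le> 4 * A" using At t r by linarith
        finally have "M * (2 * mdist X (z i) (z (Suc i))) \<le> 4 * A" .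
        moreover have "0 < A" using At t r by linarith
        ultimately show ?thesis using M(1) by (simp add: field_simps)
      qed
      ultimately have small: "norm (c - a) + 2 * mdist X (z i) (z (Suc i)) / mdist X q (z i) \<le> \<rho>\<^sup>2 / 16"
        using M(2) by (simp add: A_def add_divide_distrib[symmetric])
      have "A \<le> mdist X q (z (Suc i)) + r"
        using mdist_triangle[OF q i(2,1)] i(3) by (simp add: A_def mdist_commute)
      then have ne: "z i \<noteq> q" "z (Suc i) \<noteq> q" using At t r q by (auto simp: A_def abs_le_iff)
      obtain b where b: "z (Suc i) \<noteq> P" "b \<in> \<theta> (z (Suc i)) P" "norm (b - u\<^sub>0) \<le> \<rho> / 2"
        "F (z (Suc i)) = T *\<^sub>R u\<^sub>0 - mdist X (z (Suc i)) P *\<^sub>R b" using FP Suc.prems by blast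
      have aq: "a \<in> \<theta> q P" using a(1) th by simp
      have b\<rho>: "norm (b - u\<^sub>0) \<le> \<rho>" using b(3) \<rho> by simp
      obtain g' c' where g': "geodesic_segment X q (z (Suc i)) g'" and c': "c' \<in> \<theta> (z (Suc i)) q"
        "cos (Alexandrov_angle X g' h) \<le> - (c' \<bullet> a)"
        "mdist X (z (Suc i)) q *\<^sub>R c' + mdist X q P *\<^sub>R a = mdist X (z (Suc i)) P *\<^sub>R b"
        using straight_angle_transfer[OF i(1,2) q P ne Pq b(1) g h aq a(2) b(2) b\<rho> c(1,2) small] by blast
      have "norm c' = 1" using theta_class(1)[OF i(2) q ne(2) c'(1)] .
      moreover have "mdist X q (z (Suc i)) *\<^sub>R c' = t *\<^sub>R a + F (z 0) - F (z (Suc i))"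
        using c'(3) unfolding a(3) b(4) d(2) mdist_commute[of X "z (Suc i)" q] by (simp add: algebra_simps)
      ultimately show ?case using g' c'(2) by blast
    qed
    from this[of k] obtain c where c: "norm c = 1" "mdist X q (z k) *\<^sub>R c = t *\<^sub>R a + F (z 0) - F (z k)" by auto
    have "mdist X q (z k) = norm (t *\<^sub>R a + (F (z 0) - F (z k)))"
      using arg_cong[OF c(2), of norm] c(1) by (simp add: add_diff_eq)
    also have "\<dots> \<le> t + r"
      using norm_triangle_ineq[of "t *\<^sub>R a" "F (z 0) - F (z k)"] FF[of 0 k] na t0 by simp
    finally have "mdist X q (z k) \<le> t + r" .
    then show "mdist X (z 0) (z k) \<le> (2 * M + 1) * r"
      using mdist_triangle[OF z0 q z[OF order_refl]] d(1) mdist_commute[of X "z 0" q]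
      by (simp add: t_def algebra_simps)
  qed
qed

end

section \<open>The Lipschitz dimension of a building\<close>

context euclidean_building
begin

lemma charts_nonempty: "charts \<noteq> {}"
proof -
  obtain x where "x \<in> mspace X" using nonempty by blast
  then show ?thesis using segment_in_chart[of x x] by blast
qed

lemma building_light:
  obtains f where "Lipschitz_light X (real_space DIM('e)) f"
proof -
  obtain u\<^sub>0 \<rho> where "norm u\<^sub>0 = 1" "0 < \<rho>" "\<rho> \<le> 1"
    "\<And>w v v'. \<lbrakk>w \<in> W; norm (v - u\<^sub>0) \<le> \<rho>; norm (v' - u\<^sub>0) \<le> \<rho>\<rbrakk> \<Longrightarrow> norm (v - v') \<le> norm (v - w v')"
    using exists_regular_direction[OF W_finite W_orthogonal] by metis
  then interpret regular_building Waff X \<theta> charts u\<^sub>0 \<rho> by unfold_locales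
  obtain \<iota> where \<iota>: "\<iota> \<in> charts" using charts_nonempty by blast
  obtain F :: "'a \<Rightarrow> 'e" and M where M: "1 \<le> M"
    and lip: "\<And>x y. \<lbrakk>x \<in> mspace X; y \<in> mspace X\<rbrakk> \<Longrightarrow> norm (F x - F y) \<le> mdist X x y"
    and chain: "\<And>r z k. \<lbrakk>0 < r; \<And>i. i \<le> k \<Longrightarrow> z i \<in> mspace X; \<And>i. i < k \<Longrightarrow> mdist X (z i) (z (Suc i)) \<le> r;
       \<And>i j. i \<le> k \<Longrightarrow> j \<le> k \<Longrightarrow> norm (F (z i) - F (z j)) \<le> r\<rbrakk> \<Longrightarrow> mdist X (z 0) (z k) \<le> M * r"
    using horospherical_map[OF \<iota>] by metis
  obtain \<beta> where \<beta>: "bij_betw \<beta> {..<DIM('e)} (Basis :: 'e set)"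
    using ex_bij_betw_nat_finite[of "Basis :: 'e set"] by (auto simp: lessThan_atLeast0)
  define f where "f x i = (if i < DIM('e) then F x \<bullet> \<beta> i else 0)" for x i
  have df: "mdist (real_space DIM('e)) (f x) (f y) = norm (F x - F y)" for x y
  proof -
    have "(\<Sum>i<DIM('e). (f x i - f y i)\<^sup>2) = (\<Sum>b\<in>Basis. ((F x - F y) \<bullet> b)\<^sup>2)"
      using sum.reindex_bij_betw[OF \<beta>, of "\<lambda>b. ((F x - F y) \<bullet> b)\<^sup>2"] by (simp add: f_def inner_diff_left)
    also have "\<dots> = (norm (F x - F y))\<^sup>2"
      unfolding power2_norm_eq_inner euclidean_inner[of "F x - F y" "F x - F y"]
      by (simp add: power2_eq_square)
    finally show ?thesis by (simp add: mdist_real_space L2_set_def)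
  qed
  have "Lipschitz_light X (real_space DIM('e)) f"
    unfolding Lipschitz_light_iff_chain df
  proof (intro conjI exI[of _ M] ballI allI impI)
    show "f \<in> mspace X \<rightarrow> mspace (real_space DIM('e))" by (auto simp: f_def)
    show "0 < M" using M by simp
    show "norm (F x - F y) \<le> M * mdist X x y" if "x \<in> mspace X" "y \<in> mspace X" for x y
      using lip[OF that] mult_right_mono[OF M, of "mdist X x y"] by simp
    show "mdist X (z 0) (z k) \<le> M * r"
      if "0 < r" "\<forall>i\<le>k. z i \<in> mspace X" "\<forall>i<k. mdist X (z i) (z (Suc i)) \<le> r"
        "\<forall>i\<le>k. \<forall>j\<le>k. norm (F (z i) - F (z j)) \<le> r" for r z k
      using that by (intro chain) auto
  qed
  then show ?thesis by (rule that)
qed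

lemma building_dim_le:
  assumes light: "Lipschitz_light X (real_space k) f"
  shows "DIM('e) \<le> k"
proof -
  obtain \<iota> where \<iota>: "\<iota> \<in> charts" using charts_nonempty by blast
  obtain \<beta> where \<beta>: "bij_betw \<beta> {..<DIM('e)} (Basis :: 'e set)"
    using ex_bij_betw_nat_finite[of "Basis :: 'e set"] by (auto simp: lessThan_atLeast0)
  define v where "v x = (\<Sum>i<DIM('e). x i *\<^sub>R \<beta> i)" for x
  have \<beta>B: "\<beta> i \<in> Basis" if "i < DIM('e)" for i using \<beta> that by (auto dest: bij_betwE)
  have vi: "v x \<bullet> \<beta> i = x i" if i: "i < DIM('e)" for x i
  proof -
    have "\<beta> j \<bullet> \<beta> i = (if j = i then 1 else 0)" if "j < DIM('e)" for j
      using \<beta>B[OF that] \<beta>B[OF i] bij_betw_imp_inj_on[OF \<beta>] that i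
      by (auto simp: inner_Basis inj_on_def)
    then have "v x \<bullet> \<beta> i = (\<Sum>j<DIM('e). if j = i then x j else 0)"
      unfolding v_def inner_sum_left inner_scaleR_left by (intro sum.cong) auto
    then show ?thesis using i by simp
  qed
  have dv: "mdist X (\<iota> (v x)) (\<iota> (v y)) = norm (v x - v y)" for x y
    by (simp add: chart_dist[OF \<iota>] norm_minus_commute)
  show ?thesis
  proof (rule Lipschitz_light_cube_dim[OF light, of 1 _ "\<lambda>x. \<iota> (v x)" "DIM('e)"])
    show "\<iota> (v x) \<in> mspace X" for x using chart_mem[OF \<iota>] .
    show "mdist X (\<iota> (v x)) (\<iota> (v y)) \<le> DIM('e) * \<delta>"
      if "\<And>i. i < DIM('e) \<Longrightarrow> x i \<in> {0..1} \<and> y i \<in> {0..1} \<and> \<bar>x i - y i\<bar> \<le> \<delta>" for x y and \<delta> :: real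
    proof -
      have "v x - v y = (\<Sum>i<DIM('e). (x i - y i) *\<^sub>R \<beta> i)"
        by (simp add: v_def scaleR_diff_left sum_subtractf)
      also have "norm \<dots> \<le> (\<Sum>i<DIM('e). \<delta>)"
        using that \<beta>B by (intro sum_norm_le) simp
      finally show ?thesis by (simp add: dv)
    qed
    show "1 * \<bar>x i - y i\<bar> \<le> mdist X (\<iota> (v x)) (\<iota> (v y))" if "i < DIM('e)" for x y i
      using Basis_le_norm[OF \<beta>B[OF that], of "v x - v y"] that by (simp add: dv inner_diff_left vi)
  qed simp
qed

lemma Lipschitz_dim_building: "Lipschitz_dim X = enat DIM('e)"
  using building_light building_dim_le Lipschitz_dim_eqI by metis

end

theorem corollary5p3:
  fixes n :: nat
    and T :: "nat \<Rightarrow> 'a metric"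
    and Waff :: "('e::euclidean_space \<Rightarrow> 'e) set"
    and X :: "'b metric"
    and \<theta> :: "'b \<Rightarrow> 'b \<Rightarrow> 'e set"
    and charts :: "('e \<Rightarrow> 'b) set"
  assumes "n \<ge> 1"
  shows "((\<forall>i<n. metric_tree (T i) \<and> nontrivial (T i)) \<longrightarrow>
            Lipschitz_dim (max_product n T) = enat n) \<and>
         (euclidean_building Waff X \<theta> charts \<and> DIM('e) = n \<longrightarrow>
            Lipschitz_dim X = enat n)"
  using Lipschitz_dim_product_trees[OF assms, of T] euclidean_building.Lipschitz_dim_building by blast

end
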